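(* The cooperad $(d\mathcal{A}s)^{¡}$ is a sub-cooperad of the cofree cooperad $\mathcal{F}^c(sM_{d\mathcal{A}s})$ with trivial differential. Its underlying collection consists of free $\mathbf{k}$-modules with basis $\{\mu_{ij}: i\ge0,\ j\ge1\}$ ($\mu_{ij}$ in arity $j$), such that $\mu_{01}$ is the identity of the cooperad, $\mu_{02}=sm_{02}$ and $\mu_{11}=sm_{11}$ in $\mathcal{F}^c(sM_{d\mathcal{A}s})$, and the other $\mu_{ij}$ are defined inductively by $$\mu_{i1}=\mu_{11}(\mu_{i-1,1})\quad (i\ge1),\qquad \mu_{0n}=\sum_{p+q=n}(-1)^{p(q+1)}\mu_{02}(\mu_{0p},\mu_{0q})\quad(n\ge2),$$ $$\mu_{ij}=\mu_{11}(\mu_{i-1,j})+\sum_{r+t=i,\ s+w=j}(-1)^{|s\mu_{rs}||\mu_{tw}|+rw}\mu_{02}(\mu_{rs},\mu_{tw})\quad(i\ge1,\ j\ge2).$$ The element $\mu_{ij}$ has bidegree $(i,1-i-j)$. These elements satisfy $$\Delta(\mu_{uv})=\sum_{\substack{i+p_1+\cdots+p_j=u\\ q_1+\cdots+q_j=v}}(-1)^{X((p_1,q_1),\dots,(p_j,q_j))}\ \mu_{ij};\mu_{p_1q_1}\otimes\cdots\otimes\mu_{p_jq_j},$$ where, modulo 2, $$X((p_1,q_1),\dots,(p_j,q_j))=\sum_{k=1}^{j-1}|s\mu_{p_kq_k}|\Big(\sum_{l=k+1}^{j}|\mu_{p_lq_l}|\Big)+\sum_{k=1}^{j-1}p_k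\Big(\sum_{l=k+1}^{j}q_l\Big)=\sum_{k=1}^{j-1}\Big((p_k+q_k)(j+k)+q_k\sum_{l=k+1}^{j}(p_l+q_l)\Big).$$
   Context: Let $\mathbf{k}$ be a commutative ring. All (co)operads are non-symmetric and live in the category $\mathrm{BiCompl}_v$ of vertical bicomplexes: $(\mathbb{N},\mathbb{Z})$-bigraded $\mathbf{k}$-modules $A=\bigoplus A_i^j$ (elements of $A_i^j$ have bidegree $(i,j)$) with a differential $A_i^j\to A_i^{j+1}$; Koszul sign rule: $(f\otimes g)(x\otimes y)=(-1)^{pi+qj}f(x)\otimes g(y)$ if $g$ has bidegree $(p,q)$, $x$ bidegree $(i,j)$. For $c,d$ of bidegrees $(c_1,c_2)$, $(d_1,d_2)$, $|c||d|$ denotes the integer $c_1d_1+c_2d_2$ (extended additively in expressions such as $|c|(\sum_l|d_l|)$). The shift $s$ is $(sA)_i^j=A_i^{j+1}$, so $sc$ has bidegree $(c_1,c_2-1)$. The operad $d\mathcal{A}s$ is $\mathcal{P}(M_{d\mathcal{A}s},R_{d\mathcal{A}s})=\mathcal{F}(M_{d\mathcal{A}s})/(R_{d\mathcal{A}s})$ with trivial differential, where $M_{d\mathcal{A}s}(2)=\mathbf{k}m_{02}$ in bidegree $(0,0)$, $M_{d\mathcal{A}s}(1)=\mathbf{k}m_{11}$ in bidegree $(1,0)$, $M_{d\mathcal{A}s}(n)=0$ for $n>2$, and $$R_{d\mathcal{A}s}=\mathbf{k}(m_{02}\circ_1m_{02}-m_{02}\circ_2m_{02})\oplus\mathbf{k}m_{11}^2\oplus\mathbf{k}(m_{11}\circ_1m_{02}-m_{02}\circ_1m_{11}-m_{02}\circ_2m_{11}).$$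 For a quadratic operad $\mathcal{P}=\mathcal{P}(M,R)$, the Koszul dual cooperad $\mathcal{P}^{¡}=\mathcal{C}^c(sM,s^2R)$ is the cooperad cogenerated by $sM$ with corelations $s^2R$, i.e. the universal sub-cooperad $\mathcal{C}$ of the cofree cooperad $\mathcal{F}^c(sM)$ such that $\mathcal{C}\to\mathcal{F}^c(sM)\to\mathcal{F}^c(sM)_{(2)}/s^2R$ is zero, the subscript $(2)$ denoting trees with two vertices. Notation for cooperads: the cocomposition $\Delta:\mathcal{C}\to\mathcal{C}\circ\mathcal{C}$ is written $\Delta(c)=\sum c_j;c_I$ with $I=(i_1,\dots,i_j)$ and $c_I=c_{i_1}\otimes\cdots\otimes c_{i_j}\in\mathcal{C}^{\otimes j}$. The cofree cooperad $\mathcal{F}^c(V)$ is described by planar trees with vertices labelled by $V$; $v(t^1,\dots,t^k)$ denotes the tree with root of arity $k$ labelled by $v\in V(k)$ and subtrees $t^1,\dots,t^k$ grafted on it. With $\Delta(t^r)=\sum t^r_{j_r};t^r_{I_r}$ one has $$\Delta(v(t^1,\dots,t^k))=1;v(t^1,\dots,t^k)+\sum(-1)^{\sum_{r=1}^{k-1}|t^r_{I_r}|(\sum_{s=r+1}^{k}|t^s_{j_s}|)}\,v(t^1_{j_1},\dots,t^k_{j_k});t^1_{I_1}\otimes\cdots\otimes t^k_{I_k}.$$ In all sums, first indices are $\ge0$ and second indices (arities) are $\ge1$. *)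

theory Defs
  imports Complex_Main "HOL-Library.Poly_Mapping" "HOL-Library.Product_Plus"
begin

section \<open>Free modules\<close>

text \<open>The free \<^typ>\<open>'k\<close>-module on the set of all elements of \<^typ>\<open>'a\<close> is \<^typ>\<open>'a \<Rightarrow>\<^sub>0 'k\<close>; a basis vector is
  \<^term>\<open>Poly_Mapping.single a 1\<close>.\<close>

abbreviation bas :: "'a \<Rightarrow> 'a \<Rightarrow>\<^sub>0 'k::comm_ring_1" where
  "bas a \<equiv> Poly_Mapping.single a 1"

definition smul :: "'k::comm_ring_1 \<Rightarrow> ('a \<Rightarrow>\<^sub>0 'k) \<Rightarrow> 'a \<Rightarrow>\<^sub>0 'k" where
  "smul c x = Poly_Mapping.map ((*) c) x"

lemma lookup_smul [simp]: "Poly_Mapping.lookup (smul c x) a = c * Poly_Mapping.lookup x a"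
  by (simp add: smul_def Poly_Mapping.map.rep_eq when_def)

global_interpretation fm: module "smul :: 'k::comm_ring_1 \<Rightarrow> ('a \<Rightarrow>\<^sub>0 'k) \<Rightarrow> 'a \<Rightarrow>\<^sub>0 'k"
  defines fm_span = fm.span and fm_subspace = fm.subspace and fm_dependent = fm.dependent
  by standard (rule poly_mapping_eqI, simp add: lookup_add algebra_simps)+

definition is_basis :: "('i \<Rightarrow> 'a \<Rightarrow>\<^sub>0 'k::comm_ring_1) \<Rightarrow> 'i set \<Rightarrow> ('a \<Rightarrow>\<^sub>0 'k) set \<Rightarrow> bool" where
  "is_basis f I S \<longleftrightarrow> inj_on f I \<and> \<not> fm_dependent (f ` I) \<and> fm_span (f ` I) = S"

definition lin :: "('a \<Rightarrow> 'b \<Rightarrow>\<^sub>0 'k) \<Rightarrow> ('a \<Rightarrow>\<^sub>0 'k::comm_ring_1) \<Rightarrow> 'b \<Rightarrow>\<^sub>0 'k" where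
  "lin f x = (\<Sum>a\<in>Poly_Mapping.keys x. smul (Poly_Mapping.lookup x a) (f a))"

definition restr :: "('a \<Rightarrow> bool) \<Rightarrow> ('a \<Rightarrow>\<^sub>0 'k) \<Rightarrow> 'a \<Rightarrow>\<^sub>0 'k::comm_ring_1" where
  "restr P = lin (\<lambda>a. if P a then bas a else 0)"

text \<open>Tensor products of free modules are free on pairs, and on lists for iterated tensor powers.\<close>

definition tens2 :: "('a \<Rightarrow>\<^sub>0 'k) \<Rightarrow> ('b \<Rightarrow>\<^sub>0 'k) \<Rightarrow> ('a \<times> 'b) \<Rightarrow>\<^sub>0 'k::comm_ring_1" where
  "tens2 x y = lin (\<lambda>a. lin (\<lambda>b. bas (a, b)) y) x"

primrec tens :: "('a \<Rightarrow>\<^sub>0 'k) list \<Rightarrow> 'a list \<Rightarrow>\<^sub>0 'k::comm_ring_1" where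
  "tens [] = bas []"
| "tens (x # xs) = lin (\<lambda>a. lin (\<lambda>as. bas (a # as)) (tens xs)) x"


section \<open>Bidegrees and signs\<close>

type_synonym bideg = "nat \<times> int"

fun bdot :: "bideg \<Rightarrow> bideg \<Rightarrow> int" where
  "bdot (c1, c2) (d1, d2) = int c1 * int d1 + c2 * d2"

definition ksign :: "int \<Rightarrow> 'k::comm_ring_1" where
  "ksign n = (if even n then 1 else - 1)"

definition shift_bideg :: "bideg \<Rightarrow> bideg" where
  "shift_bideg c = (fst c, snd c - 1)"


section \<open>Collections of vertical bicomplexes\<close>

text \<open>A collection of free vertical bicomplexes, given by a homogeneous basis: all elements of
  \<^typ>\<open>'x\<close>, each with its arity, bidegree and differential.\<close>

record (overloaded) ('x, 'k) coll =
  ar :: "'x \<Rightarrow> nat"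
  bdeg :: "'x \<Rightarrow> bideg"
  dgen :: "'x \<Rightarrow> 'x \<Rightarrow>\<^sub>0 'k"

datatype 'x shifted = S 'x

text \<open>The sign in the differential of \<open>sM\<close> is the Koszul sign of the vertical differential, of bidegree
  \<open>(0, 1)\<close>, moved past \<open>s\<close>, of bidegree \<open>(0, -1)\<close>.\<close>

definition susp :: "('x, 'k::comm_ring_1) coll \<Rightarrow> ('x shifted, 'k) coll" where
  "susp M = \<lparr> ar = (\<lambda>sx. case sx of S x \<Rightarrow> ar M x),
              bdeg = (\<lambda>sx. case sx of S x \<Rightarrow> shift_bideg (bdeg M x)),
              dgen = (\<lambda>sx. case sx of S x \<Rightarrow> lin (\<lambda>y. smul (-1) (bas (S y))) (dgen M x)) \<rparr>"


section \<open>Planar trees and the cofree cooperad\<close>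

text \<open>\<^term>\<open>Leaf\<close> is the trivial tree, i.e. the identity of the (co)free (co)operad.\<close>

datatype 'x tree = Leaf | Node 'x "'x tree list"

primrec leaves :: "'x tree \<Rightarrow> nat" where
  "leaves Leaf = 1"
| "leaves (Node v ts) = sum_list (map leaves ts)"

primrec vertices :: "'x tree \<Rightarrow> nat" where
  "vertices Leaf = 0"
| "vertices (Node v ts) = 1 + sum_list (map vertices ts)"

primrec tdeg :: "('x, 'k) coll \<Rightarrow> 'x tree \<Rightarrow> bideg" where
  "tdeg V Leaf = 0"
| "tdeg V (Node v ts) = bdeg V v + sum_list (map (tdeg V) ts)"

primrec wf_tree :: "('x, 'k) coll \<Rightarrow> 'x tree \<Rightarrow> bool" where
  "wf_tree V Leaf \<longleftrightarrow> True"
| "wf_tree V (Node v ts) \<longleftrightarrow> length ts = ar V v \<and> list_all id (map (wf_tree V) ts)"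

definition corolla :: "('x, 'k) coll \<Rightarrow> 'x \<Rightarrow> 'x tree" where
  "corolla V v = Node v (replicate (ar V v) Leaf)"

definition node :: "'x \<Rightarrow> ('x tree \<Rightarrow>\<^sub>0 'k) list \<Rightarrow> 'x tree \<Rightarrow>\<^sub>0 'k::comm_ring_1" where
  "node v xs = lin (\<lambda>ts. bas (Node v ts)) (tens xs)"

definition cofree :: "('x, 'k::comm_ring_1) coll \<Rightarrow> nat \<Rightarrow> ('x tree \<Rightarrow>\<^sub>0 'k) set" where
  "cofree V n = {x. \<forall>t\<in>Poly_Mapping.keys x. wf_tree V t \<and> leaves t = n}"

text \<open>The differential is the (co)derivation extending that of \<open>V\<close>, with the Koszul signs coming from
  reading a tree as root, then subtrees from left to right.\<close>

primrec tdiff :: "('x, 'k::comm_ring_1) coll \<Rightarrow> 'x tree \<Rightarrow> 'x tree \<Rightarrow>\<^sub>0 'k" where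
  "tdiff V Leaf = 0"
| "tdiff V (Node v ts) =
     lin (\<lambda>w. bas (Node w ts)) (dgen V v)
     + (\<Sum>r<length ts. smul (ksign (bdot (0, 1) (bdeg V v + sum_list (map (tdeg V) (take r ts)))))
          (node v ((map bas ts)[r := map (tdiff V) ts ! r])))"

definition cofree_diff :: "('x, 'k::comm_ring_1) coll \<Rightarrow> ('x tree \<Rightarrow>\<^sub>0 'k) \<Rightarrow> 'x tree \<Rightarrow>\<^sub>0 'k" where
  "cofree_diff V = lin (tdiff V)"

text \<open>The composite \<open>F\<^sup>c(V) \<circ> F\<^sup>c(V)\<close> is spanned by the pairs \<open>(t, [t\<^sub>1, \<dots>, t\<^sub>j])\<close>, written
  \<open>t; t\<^sub>1 \<otimes> \<dots> \<otimes> t\<^sub>j\<close>, where \<open>t\<close> has \<open>j\<close> leaves.  The argument of \<open>deco_sign\<close> is the list of the summands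
  \<open>(t\<^sup>r\<^sub>j, t\<^sup>r\<^sub>I)\<close> chosen in the decompositions of the subtrees \<open>t\<^sup>r\<close>, \<open>r = 1, \<dots>, k\<close>.\<close>

definition deco_sign :: "('x, 'k::comm_ring_1) coll \<Rightarrow> ('x tree \<times> 'x tree list) list \<Rightarrow> 'k" where
  "deco_sign V ds = ksign (\<Sum>r<length ds. bdot (sum_list (map (tdeg V) (snd (ds ! r))))
                                          (\<Sum>l\<in>{r<..<length ds}. tdeg V (fst (ds ! l))))"

primrec tdeco :: "('x, 'k::comm_ring_1) coll \<Rightarrow> 'x tree \<Rightarrow> ('x tree \<times> 'x tree list) \<Rightarrow>\<^sub>0 'k" where
  "tdeco V Leaf = bas (Leaf, [Leaf])"
| "tdeco V (Node v ts) =
     bas (Leaf, [Node v ts])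
     + lin (\<lambda>ds. smul (deco_sign V ds) (bas (Node v (map fst ds), concat (map snd ds))))
         (tens (map (tdeco V) ts))"

definition cofree_deco ::
  "('x, 'k::comm_ring_1) coll \<Rightarrow> ('x tree \<Rightarrow>\<^sub>0 'k) \<Rightarrow> ('x tree \<times> 'x tree list) \<Rightarrow>\<^sub>0 'k" where
  "cofree_deco V = lin (tdeco V)"


section \<open>Sub-cooperads and cogenerated cooperads\<close>

text \<open>The arity \<open>n\<close> part of \<open>C \<circ> C\<close>, as a submodule of \<open>F\<^sup>c(V) \<circ> F\<^sup>c(V)\<close>: over a general ring
  this is the image of \<open>C \<circ> C\<close>, which may fail to be injective for an arbitrary submodule \<open>C\<close>.  The
  universal property below therefore ranges over the images of all cooperads mapping to \<open>F\<^sup>c(V)\<close>.\<close>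

definition circ :: "(nat \<Rightarrow> ('x tree \<Rightarrow>\<^sub>0 'k) set) \<Rightarrow> nat \<Rightarrow>
    (('x tree \<times> 'x tree list) \<Rightarrow>\<^sub>0 'k::comm_ring_1) set" where
  "circ C n = fm_span {tens2 c (tens cs) | c cs ns.
      c \<in> C (length ns) \<and> list_all2 (\<lambda>x m. x \<in> C m) cs ns \<and> sum_list ns = n}"

definition subcooperad ::
    "('x, 'k::comm_ring_1) coll \<Rightarrow> (nat \<Rightarrow> ('x tree \<Rightarrow>\<^sub>0 'k) set) \<Rightarrow> bool" where
  "subcooperad V C \<longleftrightarrow> (\<forall>n.
     C n \<subseteq> cofree V n \<and> fm_subspace (C n) \<and>
     (\<forall>x\<in>C n. \<forall>b. restr (\<lambda>t. tdeg V t = b) x \<in> C n) \<and>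
     (\<forall>x\<in>C n. cofree_diff V x \<in> C n) \<and>
     (\<forall>x\<in>C n. cofree_deco V x \<in> circ C n))"

text \<open>The composite \<open>C \<rightarrow> F\<^sup>c(V) \<rightarrow> F\<^sup>c(V)\<^sub>(\<^sub>2\<^sub>) / R\<close> is zero.\<close>

definition satisfies_corelations ::
    "('x tree \<Rightarrow>\<^sub>0 'k) set \<Rightarrow> (nat \<Rightarrow> ('x tree \<Rightarrow>\<^sub>0 'k::comm_ring_1) set) \<Rightarrow> bool" where
  "satisfies_corelations R C \<longleftrightarrow> (\<forall>n. \<forall>x\<in>C n. restr (\<lambda>t. vertices t = 2) x \<in> R)"

definition is_cogenerated_cooperad :: "('x, 'k::comm_ring_1) coll \<Rightarrow> ('x tree \<Rightarrow>\<^sub>0 'k) set \<Rightarrow>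
    (nat \<Rightarrow> ('x tree \<Rightarrow>\<^sub>0 'k) set) \<Rightarrow> bool" where
  "is_cogenerated_cooperad V R C \<longleftrightarrow>
     subcooperad V C \<and> satisfies_corelations R C \<and>
     (\<forall>C'. subcooperad V C' \<and> satisfies_corelations R C' \<longrightarrow> (\<forall>n. C' n \<subseteq> C n))"

definition cogenerated_cooperad :: "('x, 'k::comm_ring_1) coll \<Rightarrow> ('x tree \<Rightarrow>\<^sub>0 'k) set \<Rightarrow>
    nat \<Rightarrow> ('x tree \<Rightarrow>\<^sub>0 'k) set" where
  "cogenerated_cooperad V R = (THE C. is_cogenerated_cooperad V R C)"


section \<open>Koszul dual cooperads\<close>

text \<open>On the module of trees with two vertices \<open>v\<close> (the root) and \<open>w\<close>, \<open>s\<^sup>2\<close> is \<open>s \<otimes> s\<close>: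
  it relabels \<open>v, w\<close> by \<open>sv, sw\<close>, and the Koszul sign comes from moving the second \<open>s\<close> past \<open>v\<close>.\<close>

fun shift2 :: "('x, 'k::comm_ring_1) coll \<Rightarrow> 'x tree \<Rightarrow> 'x shifted tree \<Rightarrow>\<^sub>0 'k" where
  "shift2 M Leaf = 0"
| "shift2 M (Node v ts) = smul (ksign (bdot (0, -1) (bdeg M v))) (bas (map_tree S (Node v ts)))"

text \<open>For the quadratic operad \<open>F(M)/(R)\<close>, with \<open>R\<close> a submodule of the two-vertex part of \<open>F(M)\<close>.\<close>

definition koszul_dual :: "('x, 'k::comm_ring_1) coll \<Rightarrow> ('x tree \<Rightarrow>\<^sub>0 'k) set \<Rightarrow>
    nat \<Rightarrow> ('x shifted tree \<Rightarrow>\<^sub>0 'k) set" where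
  "koszul_dual M R = cogenerated_cooperad (susp M) (lin (shift2 M) ` R)"


section \<open>The quadratic presentation of the operad dAs\<close>

datatype dAs_gen = m02 | m11

definition M_dAs :: "(dAs_gen, 'k::comm_ring_1) coll" where
  "M_dAs = \<lparr> ar = (\<lambda>x. case x of m02 \<Rightarrow> 2 | m11 \<Rightarrow> 1),
             bdeg = (\<lambda>x. case x of m02 \<Rightarrow> (0, 0) | m11 \<Rightarrow> (1, 0)),
             dgen = (\<lambda>x. 0) \<rparr>"

text \<open>The partial composite \<open>v \<circ>\<^sub>i w\<close> of two generators in the free operad.\<close>

definition pcomp :: "('x, 'k::comm_ring_1) coll \<Rightarrow> 'x \<Rightarrow> nat \<Rightarrow> 'x \<Rightarrow> 'x tree \<Rightarrow>\<^sub>0 'k" where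
  "pcomp M v i w = bas (Node v ((replicate (ar M v) Leaf)[i - 1 := corolla M w]))"

definition R_dAs :: "(dAs_gen tree \<Rightarrow>\<^sub>0 'k::comm_ring_1) set" where
  "R_dAs = fm_span
    {pcomp M_dAs m02 1 m02 - pcomp M_dAs m02 2 m02,
     pcomp M_dAs m11 1 m11,
     pcomp M_dAs m11 1 m02 - pcomp M_dAs m02 1 m11 - pcomp M_dAs m02 2 m11}"

abbreviation sM_dAs :: "(dAs_gen shifted, 'k::comm_ring_1) coll" where
  "sM_dAs \<equiv> susp M_dAs"

definition dAs_dual :: "nat \<Rightarrow> (dAs_gen shifted tree \<Rightarrow>\<^sub>0 'k::comm_ring_1) set" where
  "dAs_dual = koszul_dual M_dAs R_dAs"


section \<open>The elements \<open>\<mu>\<^sub>i\<^sub>j\<close>\<close>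

definition mu_deg :: "nat \<Rightarrow> nat \<Rightarrow> bideg" where
  "mu_deg i j = (i, 1 - int i - int j)"

function mu :: "nat \<Rightarrow> nat \<Rightarrow> dAs_gen shifted tree \<Rightarrow>\<^sub>0 'k::comm_ring_1" where
  "mu i j =
    (if j = 0 then 0
     else if j = 1 then (if i = 0 then bas Leaf else node (S m11) [mu (i - 1) 1])
     else if i = 0 then
       (\<Sum>(p, q) \<in> {(p, q). 1 \<le> p \<and> 1 \<le> q \<and> p + q = j}.
          smul (ksign (int p * (int q + 1))) (node (S m02) [mu 0 p, mu 0 q]))
     else
       node (S m11) [mu (i - 1) j]
       + (\<Sum>(r, t, s, w) \<in> {(r, t, s, w). 1 \<le> s \<and> 1 \<le> w \<and> r + t = i \<and> s + w = j}.
            smul (ksign (bdot (shift_bideg (mu_deg r s)) (mu_deg t w) + int r * int w))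
              (node (S m02) [mu r s, mu t w])))"
  by pat_completeness auto
termination
  by (relation "measure (\<lambda>(i, j). i + j)") auto

declare mu.simps [simp del]


section \<open>The sign exponents\<close>

text \<open>The sequence \<open>(p\<^sub>1, q\<^sub>1), \<dots>, (p\<^sub>j, q\<^sub>j)\<close> is a list of pairs; \<open>P ps k\<close> and \<open>Q ps k\<close> use the 1-based
  index \<open>k\<close>.\<close>

abbreviation P :: "(nat \<times> nat) list \<Rightarrow> nat \<Rightarrow> nat" where "P ps k \<equiv> fst (ps ! (k - 1))"
abbreviation Q :: "(nat \<times> nat) list \<Rightarrow> nat \<Rightarrow> nat" where "Q ps k \<equiv> snd (ps ! (k - 1))"

definition X :: "(nat \<times> nat) list \<Rightarrow> int" where
  "X ps = (let j = length ps in
     (\<Sum>k = 1..j - 1. bdot (shift_bideg (mu_deg (P ps k) (Q ps k)))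
                           (\<Sum>l = k + 1..j. mu_deg (P ps l) (Q ps l)))
     + (\<Sum>k = 1..j - 1. int (P ps k) * (\<Sum>l = k + 1..j. int (Q ps l))))"

definition X' :: "(nat \<times> nat) list \<Rightarrow> int" where
  "X' ps = (let j = length ps in
     (\<Sum>k = 1..j - 1. int (P ps k + Q ps k) * int (j + k)
                      + int (Q ps k) * (\<Sum>l = k + 1..j. int (P ps l + Q ps l))))"

text \<open>The index set of the sum in the decomposition of \<open>\<mu>\<^sub>u\<^sub>v\<close>; the index \<open>j\<close> is the length of the list.\<close>

definition deco_index :: "nat \<Rightarrow> nat \<Rightarrow> (nat \<times> (nat \<times> nat) list) set" where
  "deco_index u v = {(i, ps). ps \<noteq> [] \<and> (\<forall>(p, q)\<in>set ps. 1 \<le> q) \<and>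
      i + sum_list (map fst ps) = u \<and> sum_list (map snd ps) = v}"

end

theory Submission
  imports Defs
begin

text \<open>Up to sign, every tree with \<open>i\<close> unary vertices and \<open>j\<close> leaves occurs exactly once in \<open>\<mu>\<^sub>i\<^sub>j\<close>; let
  \<open>eps t = \<plusminus>1\<close> be its coefficient.  The decomposition of a tree \<open>t\<close> is the signed sum of all ways to
  write \<open>t\<close> as a tree \<open>u\<close> with trees \<open>ts\<close> grafted onto its leaves, and the sign is
  \<open>(-1)\<^sup>X eps u (\<Prod> eps ts) eps t\<close>, where \<open>X\<close> depends only on the numbers of unary vertices and leaves of
  the \<open>ts\<close>.  Collecting the grafted trees by these numbers gives the formula for \<open>\<Delta>(\<mu>\<^sub>u\<^sub>v)\<close>, so the \<open>\<mu>\<^sub>i\<^sub>j\<close>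
  span a sub-cooperad.

  For maximality, let \<open>C\<close> be a sub-cooperad satisfying the corelations, and call two trees coherent if
  \<open>eps t x\<^sub>t\<close> is the same for both, for all \<open>x \<in> C\<close>.  Coherence is stable under grafting, by the sign
  formula and since \<open>\<Delta>(x)\<close> lies in \<open>C \<circ> C\<close>; the corelations say that two-vertex trees of equal type are
  coherent.  As these generate all local moves, every tree is coherent to a normal form depending only
  on its type, so \<open>x\<close> is a combination of the \<open>\<mu>\<^sub>i\<^sub>j\<close>.\<close>

section \<open>Free modules and sign exponents\<close>

lemma lookup_sum_pm: "Poly_Mapping.lookup (sum f A) b = (\<Sum>a\<in>A. Poly_Mapping.lookup (f a) b)"
  by (induction A rule: infinite_finite_induct) (auto simp: lookup_add)

lemma lookup_lin:
  "Poly_Mapping.lookup (lin f x) b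
     = (\<Sum>a\<in>Poly_Mapping.keys x. Poly_Mapping.lookup x a * Poly_Mapping.lookup (f a) b)"
  by (simp add: lin_def lookup_sum_pm)

lemma lookup_lin_superset:
  assumes "finite A" "Poly_Mapping.keys x \<subseteq> A"
  shows "Poly_Mapping.lookup (lin f x) b = (\<Sum>a\<in>A. Poly_Mapping.lookup x a * Poly_Mapping.lookup (f a) b)"
  unfolding lookup_lin using assms
  by (intro sum.mono_neutral_left) (auto simp: in_keys_iff)

text \<open>Most maps here send basis vectors to multiples of basis vectors in an essentially
  injective way, so a coefficient of the image comes from a single \<open>a0\<close>. This turns
  identities of linear combinations into identities of single coefficients.\<close>

lemma lookup_lin_unique:
  assumes "\<And>a. Poly_Mapping.lookup x a \<noteq> 0 \<Longrightarrow> a \<noteq> a0 \<Longrightarrow> Poly_Mapping.lookup (f a) b = 0"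
  shows "Poly_Mapping.lookup (lin f x) b = Poly_Mapping.lookup x a0 * Poly_Mapping.lookup (f a0) b"
proof -
  have "Poly_Mapping.lookup (lin f x) b
      = (\<Sum>a\<in>insert a0 (Poly_Mapping.keys x). Poly_Mapping.lookup x a * Poly_Mapping.lookup (f a) b)"
    by (rule lookup_lin_superset) auto
  also have "\<dots> = (\<Sum>a\<in>{a0}. Poly_Mapping.lookup x a * Poly_Mapping.lookup (f a) b)"
    using assms by (intro sum.mono_neutral_right) (auto simp: in_keys_iff)
  finally show ?thesis by simp
qed

lemma lookup_lin_zero:
  assumes "\<And>a. Poly_Mapping.lookup x a \<noteq> 0 \<Longrightarrow> Poly_Mapping.lookup (f a) b = 0"
  shows "Poly_Mapping.lookup (lin f x) b = 0"
  unfolding lookup_lin using assms by (intro sum.neutral) (auto simp: in_keys_iff)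

lemma lin_add: "lin f (x + y) = lin f x + lin f y"
proof (rule poly_mapping_eqI)
  fix b
  let ?A = "Poly_Mapping.keys x \<union> Poly_Mapping.keys y"
  have *: "Poly_Mapping.lookup (lin f z) b = (\<Sum>a\<in>?A. Poly_Mapping.lookup z a * Poly_Mapping.lookup (f a) b)"
    if "Poly_Mapping.keys z \<subseteq> ?A" for z
    using that by (intro lookup_lin_superset) auto
  show "Poly_Mapping.lookup (lin f (x + y)) b = Poly_Mapping.lookup (lin f x + lin f y) b"
    using keys_add[of x y] by (simp add: * lookup_add distrib_right sum.distrib)
qed

lemma lin_smul: "lin f (smul c x) = smul c (lin f x)"
proof (rule poly_mapping_eqI)
  fix b
  have "Poly_Mapping.lookup (lin f (smul c x)) b
      = (\<Sum>a\<in>Poly_Mapping.keys x. Poly_Mapping.lookup (smul c x) a * Poly_Mapping.lookup (f a) b)"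
    by (rule lookup_lin_superset) (auto simp: in_keys_iff)
  then show "Poly_Mapping.lookup (lin f (smul c x)) b = Poly_Mapping.lookup (smul c (lin f x)) b"
    by (simp add: lookup_lin sum_distrib_left mult.assoc)
qed

lemma module_hom_lin: "module_hom smul smul (lin f)"
  by standard (simp_all add: lin_add lin_smul)

lemma lin_zero [simp]: "lin f 0 = 0"
  by (simp add: lin_def)

lemma lin_sum: "lin f (sum g A) = (\<Sum>a\<in>A. lin f (g a))"
  by (induction A rule: infinite_finite_induct) (auto simp: lin_add)

lemma lin_bas [simp]: "lin f (bas a) = f a"
  by (rule poly_mapping_eqI) (simp add: lookup_lin)

lemma lin_lin: "lin f (lin g x) = lin (\<lambda>a. lin f (g a)) x"
  by (simp add: lin_def[of _ x] lin_def[of g x] lin_sum lin_smul)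

lemma lookup_restr [simp]:
  "Poly_Mapping.lookup (restr p x) a = (if p a then Poly_Mapping.lookup x a else 0)"
proof -
  have "Poly_Mapping.lookup (restr p x) a = Poly_Mapping.lookup x a
      * Poly_Mapping.lookup (if p a then bas a else 0) a"
    unfolding restr_def by (rule lookup_lin_unique) (auto simp: lookup_single)
  then show ?thesis by simp
qed

lemma restr_add: "restr p (x + y) = restr p x + restr p y"
  by (rule poly_mapping_eqI) (simp add: lookup_add)

lemma restr_smul: "restr p (smul c x) = smul c (restr p x)"
  by (rule poly_mapping_eqI) simp

lemma lookup_tens2 [simp]:
  "Poly_Mapping.lookup (tens2 x y) (a, b) = Poly_Mapping.lookup x a * Poly_Mapping.lookup y b"
proof -
  have "Poly_Mapping.lookup (tens2 x y) (a, b)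
      = Poly_Mapping.lookup x a * Poly_Mapping.lookup (lin (\<lambda>b. bas (a, b)) y) (a, b)"
    unfolding tens2_def by (rule lookup_lin_unique) (auto intro!: lookup_lin_zero simp: lookup_single)
  also have "Poly_Mapping.lookup (lin (\<lambda>b. bas (a, b)) y) (a, b)
      = Poly_Mapping.lookup y b * Poly_Mapping.lookup (bas (a, b)) (a, b)"
    by (rule lookup_lin_unique) (auto simp: lookup_single)
  finally show ?thesis by simp
qed

lemma lookup_tens:
  "Poly_Mapping.lookup (tens xs) ts
     = (if length xs = length ts then prod_list (map2 Poly_Mapping.lookup xs ts) else 0)"
proof (induction xs arbitrary: ts)
  case Nil
  show ?case by (cases ts) (auto simp: lookup_single)
next
  case (Cons x xs)
  show ?case
  proof (cases ts)
    case Nil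
    then show ?thesis by (auto intro!: lookup_lin_zero simp: lookup_single)
  next
    case (Cons a as)
    have "Poly_Mapping.lookup (tens (x # xs)) (a # as)
        = Poly_Mapping.lookup x a * Poly_Mapping.lookup (lin (\<lambda>as. bas (a # as)) (tens xs)) (a # as)"
      unfolding tens.simps
      by (rule lookup_lin_unique) (auto intro!: lookup_lin_zero simp: lookup_single)
    also have "Poly_Mapping.lookup (lin (\<lambda>as. bas (a # as)) (tens xs)) (a # as)
        = Poly_Mapping.lookup (tens xs) as * Poly_Mapping.lookup (bas (a # as)) (a # as)"
      by (rule lookup_lin_unique) (auto simp: lookup_single)
    finally show ?thesis by (simp add: Cons Cons.IH)
  qed
qed

lemma lin_tens_1: "lin f (tens [x]) = lin (\<lambda>a. f [a]) x"
  by (simp add: lin_lin)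

lemma lin_tens_2: "lin f (tens [x, y]) = lin (\<lambda>a. lin (\<lambda>b. f [a, b]) y) x"
  by (simp add: lin_lin)

lemma lookup_node:
  "Poly_Mapping.lookup (node v xs) t = (case t of Leaf \<Rightarrow> 0 | Node w ts \<Rightarrow>
     if w = v \<and> length xs = length ts then prod_list (map2 Poly_Mapping.lookup xs ts) else 0)"
proof (cases t)
  case Leaf
  then show ?thesis by (auto simp: node_def intro!: lookup_lin_zero simp: lookup_single)
next
  case (Node w ts)
  have "Poly_Mapping.lookup (node v xs) t
      = Poly_Mapping.lookup (tens xs) ts * Poly_Mapping.lookup (bas (Node v ts)) t"
    unfolding node_def Node by (rule lookup_lin_unique) (auto simp: lookup_single)
  then show ?thesis by (simp add: Node lookup_tens lookup_single)
qed

lemma node_zero: "0 \<in> set xs \<Longrightarrow> node v xs = 0"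
proof (rule poly_mapping_eqI)
  fix t :: "'a tree"
  assume z: "0 \<in> set xs"
  have "prod_list (map2 Poly_Mapping.lookup xs ts) = 0" if "length xs = length ts" for ts
    using that z by (induction xs ts rule: list_induct2) auto
  then show "Poly_Mapping.lookup (node v xs) t = Poly_Mapping.lookup 0 t"
    by (auto simp: lookup_node split: tree.split)
qed

section \<open>Signs and the two forms of the exponent\<close>

lemma ksign_add: "ksign (m + n) = ksign m * ksign n"
  by (auto simp: ksign_def)

lemma ksign_square [simp]: "ksign n * ksign n = 1"
  by (auto simp: ksign_def)

lemma ksign_square_left [simp]: "ksign n * (ksign n * x) = x"
  by (simp flip: mult.assoc)

lemma ksign_cong: "even (m - n) \<Longrightarrow> ksign m = ksign n"
  by (auto simp: ksign_def)

lemma ksign_0 [simp]: "ksign 0 = 1"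
  by (simp add: ksign_def)

lemma bdot_zero_right [simp]: "bdot c 0 = 0"
  by (cases c) (simp add: zero_prod_def)

text \<open>A total bidegree depends only on the length of the list and on the two sums, so the sign
  computations below become polynomial identities in a few integers.\<close>

lemma sum_list_mu_deg:
  "(\<Sum>(p, q)\<leftarrow>ps. mu_deg p q)
     = (sum_list (map fst ps), int (length ps) - int (sum_list (map fst ps)) - int (sum_list (map snd ps)))"
  by (induction ps) (auto simp: mu_deg_def zero_prod_def)

lemma sum_indices_eq:
  fixes g :: "'a \<Rightarrow> 'b::comm_monoid_add"
  shows "(\<Sum>l = Suc k..length xs. g (xs ! (l - 1))) = sum_list (map g (drop k xs))"
proof (cases "k \<le> length xs")
  case True
  have "(\<Sum>l = Suc k..length xs. g (xs ! (l - 1))) = (\<Sum>l\<in>{k..<length xs}. g (xs ! l))"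
    by (rule sum.reindex_bij_witness[of _ Suc "\<lambda>l. l - 1"]) auto
  also have "\<dots> = sum_list (map g (drop k xs))"
    using True
    by (simp add: sum_list_sum_nth atLeast0LessThan)
      (rule sum.reindex_bij_witness[of _ "\<lambda>l. k + l" "\<lambda>l. l - k"], auto)
  finally show ?thesis .
qed simp

text \<open>Splits off the index 1 and shifts the others. The assumption on \<open>h x []\<close>
  covers a one-element list, where the sum on the left is empty.\<close>

lemma sum_tails:
  fixes h :: "'a \<Rightarrow> 'a list \<Rightarrow> int"
  assumes "\<And>x. h x [] = 0"
  shows "(\<Sum>k = 1..length (x # xs) - 1. h ((x # xs) ! (k - 1)) (drop k (x # xs)))
       = h x xs + (\<Sum>k = 1..length xs - 1. h (xs ! (k - 1)) (drop k xs))"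
proof (cases xs)
  case Nil
  then show ?thesis by (simp add: assms)
next
  case (Cons y ys)
  have "(\<Sum>k = 1..Suc (length ys). h ((x # xs) ! (k - 1)) (drop k (x # xs)))
      = h x xs + (\<Sum>k = Suc 1..Suc (length ys). h ((x # xs) ! (k - 1)) (drop k (x # xs)))"
    by (subst sum.atLeast_Suc_atMost) auto
  also have "(\<Sum>k = Suc 1..Suc (length ys). h ((x # xs) ! (k - 1)) (drop k (x # xs)))
      = (\<Sum>k = 1..length ys. h (xs ! (k - 1)) (drop k xs))"
    by (subst sum.shift_bounds_cl_Suc_ivl) (auto intro!: sum.cong simp: nth_Cons split: nat.split)
  finally show ?thesis by (simp add: Cons)
qed

text \<open>Each summand of \<open>X\<close> depends only on an entry and on the list behind it.
  This is the shape that allows recursion on the list.\<close>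

lemma X_tails:
  "X ps = (\<Sum>k = 1..length ps - 1. (\<lambda>(p, q) rs.
      bdot (shift_bideg (mu_deg p q)) (\<Sum>(p, q)\<leftarrow>rs. mu_deg p q) + int p * int (sum_list (map snd rs)))
      (ps ! (k - 1)) (drop k ps))"
proof -
  have 1: "(\<Sum>l = k + 1..length ps. mu_deg (P ps l) (Q ps l)) = (\<Sum>(p, q)\<leftarrow>drop k ps. mu_deg p q)" for k
    using sum_indices_eq[where g = "\<lambda>(p, q). mu_deg p q" and k = k and xs = ps] by (simp add: case_prod_beta)
  have 2: "(\<Sum>l = k + 1..length ps. int (Q ps l)) = int (sum_list (map snd (drop k ps)))" for k
    using sum_indices_eq[where g = "\<lambda>x. int (snd x)" and k = k and xs = ps]
    by (simp flip: sum_list_of_nat add: comp_def)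
  show ?thesis
    unfolding X_def Let_def 1 2 by (simp add: sum.distrib case_prod_beta)
qed


lemma X_Nil [simp]: "X [] = 0"
  by (simp add: X_def)

lemma X_Cons: "X (x # ps) = bdot (shift_bideg (mu_deg (fst x) (snd x))) (\<Sum>(p, q)\<leftarrow>ps. mu_deg p q)
    + int (fst x) * int (sum_list (map snd ps)) + X ps"
proof -
  define h :: "nat \<times> nat \<Rightarrow> (nat \<times> nat) list \<Rightarrow> int" where
    "h = (\<lambda>(p, q) rs. bdot (shift_bideg (mu_deg p q)) (\<Sum>(p, q)\<leftarrow>rs. mu_deg p q)
       + int p * int (sum_list (map snd rs)))"
  have "X ps = (\<Sum>k = 1..length ps - 1. h (ps ! (k - 1)) (drop k ps))" for ps
    by (simp add: X_tails h_def)
  moreover have "h x [] = 0" for x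
    by (simp add: h_def split: prod.split)
  ultimately have "X (x # ps) = h x ps + X ps"
    using sum_tails[of h x ps] by simp
  then show ?thesis
    by (simp add: h_def split: prod.split)
qed

text \<open>Every pair of an entry of \<open>ps\<close> and an entry of \<open>qs\<close>
  contributes once, which gives a product of totals. The shifts lower the second degree by one for
  each entry of \<open>ps\<close>, hence the summand \<open>(0, - int (length ps))\<close>.\<close>

lemma X_append:
  "X (ps @ qs) = X ps + X qs
     + bdot ((\<Sum>(p, q)\<leftarrow>ps. mu_deg p q) + (0, - int (length ps))) (\<Sum>(p, q)\<leftarrow>qs. mu_deg p q)
     + int (sum_list (map fst ps)) * int (sum_list (map snd qs))"
proof (induction ps)
  case (Cons x ps)
  then show ?case
    unfolding append_Cons X_Cons unfolding sum_list_mu_deg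
    by (simp add: shift_bideg_def mu_deg_def algebra_simps)
qed (simp add: sum_list_mu_deg)

text \<open>The two exponents agree modulo 2 already summand by summand.\<close>

lemma X_X': "even (X ps - X' ps)"
proof -
  have "even ((case ps ! (k - 1) of (p, q) \<Rightarrow> \<lambda>rs.
       bdot (shift_bideg (mu_deg p q)) (\<Sum>(p, q)\<leftarrow>rs. mu_deg p q) + int p * int (sum_list (map snd rs)))
         (drop k ps)
     - (int (P ps k + Q ps k) * int (length ps + k)
        + int (Q ps k) * (\<Sum>l = k + 1..length ps. int (P ps l + Q ps l))))"
    (is "even ?d") if "k \<in> {1..length ps - 1}" for k
  proof -
    have 1: "(\<Sum>l = k + 1..length ps. int (P ps l + Q ps l))
        = int (sum_list (map fst (drop k ps))) + int (sum_list (map snd (drop k ps)))"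
      using sum_indices_eq[where g = "\<lambda>x. int (fst x + snd x)" and k = k and xs = ps]
      by (simp flip: sum_list_of_nat add: comp_def sum_list_addf)
    obtain p q where pq: "ps ! (k - 1) = (p, q)" by fastforce
    obtain a b where ab: "sum_list (map fst (drop k ps)) = a" "sum_list (map snd (drop k ps)) = b"
      by blast
    \<comment> \<open>The number of entries behind position \<open>k\<close>; it enters through the
      constant 1 in the second degree of each of them.\<close>
    define j where "j = length ps - k"
    have j: "length ps = j + k"
      using that by (auto simp: j_def)
    have "?d = 2 * (int p * a - int (p + q) * (int j + int k) + int p * b)"
      unfolding 1 sum_list_mu_deg
      by (simp add: j pq[simplified] ab shift_bideg_def mu_deg_def algebra_simps)
    then show ?thesis by simp
  qed
  then show ?thesis
    unfolding X_tails X'_def Let_def sum_subtractf[symmetric] by (rule dvd_sum)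
qed


section \<open>Coefficients of \<open>\<mu>\<^sub>i\<^sub>j\<close> and of the decomposition map\<close>

abbreviation un :: "dAs_gen shifted tree \<Rightarrow> dAs_gen shifted tree" where
  "un t \<equiv> Node (S m11) [t]"

abbreviation bin :: "dAs_gen shifted tree \<Rightarrow> dAs_gen shifted tree \<Rightarrow> dAs_gen shifted tree" where
  "bin t u \<equiv> Node (S m02) [t, u]"

text \<open>An inductive description of the well-formed trees over \<open>sM_dAs\<close>, for rule
  induction and for case analysis on the root.\<close>

inductive dtree :: "dAs_gen shifted tree \<Rightarrow> bool" where
  Leaf [intro, simp]: "dtree Leaf"
| un: "dtree t \<Longrightarrow> dtree (un t)"
| bin: "dtree t \<Longrightarrow> dtree u \<Longrightarrow> dtree (bin t u)"

lemma dtree_un [simp]: "dtree (un t) \<longleftrightarrow> dtree t"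
  by (auto intro: dtree.un elim: dtree.cases)

lemma dtree_bin [simp]: "dtree (bin t u) \<longleftrightarrow> dtree t \<and> dtree u"
  by (auto intro: dtree.bin elim: dtree.cases)

lemma sM_dAs_simps [simp]:
  "ar sM_dAs (S m02) = 2" "ar sM_dAs (S m11) = 1"
  "bdeg sM_dAs (S m02) = (0, -1)" "bdeg sM_dAs (S m11) = (1, -1)"
  "dgen sM_dAs v = 0"
  by (simp_all add: susp_def M_dAs_def shift_bideg_def split: shifted.split)

lemma dtree_iff_wf_tree: "dtree t \<longleftrightarrow> wf_tree (sM_dAs :: (_, 'k::comm_ring_1) coll) t"
proof
  show "dtree t \<Longrightarrow> wf_tree (sM_dAs :: (_, 'k) coll) t"
    by (induction rule: dtree.induct) auto
  show "wf_tree (sM_dAs :: (_, 'k) coll) t \<Longrightarrow> dtree t"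
  proof (induction t)
    case (Node v ts)
    obtain g where v: "v = S g" by (cases v)
    show ?case
    proof (cases g)
      case m02
      then have "length ts = Suc (Suc 0)" using Node.prems by (simp add: v)
      then obtain t u where "ts = [t, u]" by (auto simp: length_Suc_conv)
      then show ?thesis using Node m02 by (auto simp: v)
    next
      case m11
      then have "length ts = Suc 0" using Node.prems by (simp add: v)
      then obtain t where "ts = [t]" by (auto simp: length_Suc_conv)
      then show ?thesis using Node m11 by (auto simp: v)
    qed
  qed simp
qed

text \<open>Counts the unary vertices. Together with the number of leaves it determines the bidegree
  and the number of vertices.\<close>

primrec nb :: "dAs_gen shifted tree \<Rightarrow> nat" where
  "nb Leaf = 0"
| "nb (Node v ts) = (if v = S m11 then 1 else 0) + sum_list (map nb ts)"

abbreviation ty :: "dAs_gen shifted tree \<Rightarrow> nat \<times> nat" where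
  "ty t \<equiv> (nb t, leaves t)"

text \<open>The exponent in the recursion for \<open>mu\<close>, with x = (r, s) and y = (t,
  w).\<close>

definition bin_sign :: "nat \<times> nat \<Rightarrow> nat \<times> nat \<Rightarrow> int" where
  "bin_sign x y = bdot (shift_bideg (mu_deg (fst x) (snd x))) (mu_deg (fst y) (snd y))
     + int (fst x) * int (snd y)"

text \<open>The product of the recursion signs of \<open>mu\<close> over all binary vertices, each
  taken at the types of its two subtrees. Unary vertices contribute the default factor 1.\<close>

primrec eps :: "dAs_gen shifted tree \<Rightarrow> 'k::comm_ring_1" where
  "eps Leaf = 1"
| "eps (Node v ts) = prod_list (map eps ts)
     * (case ts of [t, u] \<Rightarrow> ksign (bin_sign (ty t) (ty u)) | _ \<Rightarrow> 1)"

lemma eps_square [simp]: "dtree t \<Longrightarrow> eps t * eps t = 1"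
proof (induction rule: dtree.induct)
  case (bin t u)
  let ?s = "ksign (bin_sign (ty t) (ty u)) :: 'a"
  have "eps (bin t u) * eps (bin t u) = (eps t * eps t) * (eps u * eps u) * (?s * ?s)"
    by (simp add: ac_simps del: ksign_square ksign_square_left)
  then show ?case by (simp add: bin.IH)
qed auto

lemma eps_square_left [simp]: "dtree t \<Longrightarrow> eps t * (eps t * x) = x"
  by (simp flip: mult.assoc)

lemma eps_nonzero: "dtree t \<Longrightarrow> eps t \<noteq> (0 :: 'k::comm_ring_1)"
  using eps_square[of t, where 'a = 'k] by (metis mult_zero_left zero_neq_one)

lemma leaves_pos: "dtree t \<Longrightarrow> 1 \<le> leaves t"
  by (induction rule: dtree.induct) auto

lemma tdeg_dtree: "dtree t \<Longrightarrow> tdeg sM_dAs t = mu_deg (nb t) (leaves t)"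
  by (induction rule: dtree.induct) (auto simp: mu_deg_def zero_prod_def)

text \<open>Each binary vertex adds one leaf, so there is one leaf more than there are binary
  vertices.\<close>

lemma vertices_dtree: "dtree t \<Longrightarrow> vertices t + 1 = nb t + leaves t"
  by (induction rule: dtree.induct) auto

lemma ty_01: "dtree t \<and> nb t = 0 \<and> leaves t = 1 \<longleftrightarrow> t = Leaf"
proof
  assume *: "dtree t \<and> nb t = 0 \<and> leaves t = 1"
  then have "dtree t" by blast
  then show "t = Leaf"
    using * by cases (auto dest!: leaves_pos)
qed auto

definition splits :: "nat \<Rightarrow> nat \<Rightarrow> (nat \<times> nat \<times> nat \<times> nat) set" where
  "splits i j = {(r, t, s, w). 1 \<le> s \<and> 1 \<le> w \<and> r + t = i \<and> s + w = j}"

lemma finite_splits [simp]: "finite (splits i j)"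
  by (rule finite_subset[of _ "{..i} \<times> {..i} \<times> {..j} \<times> {..j}"]) (auto simp: splits_def)

text \<open>The cases of the definition of \<open>mu\<close> merge into one recursion: for
  \<open>j = 1\<close> there are no splittings, and for \<open>i = 0\<close> the exponents p(q+1)
  and \<open>bin_sign (0, p) (0, q)\<close> = p(q-1) have the same parity.\<close>

lemma mu_rec:
  assumes "1 \<le> j" "(i, j) \<noteq> (0, 1)"
  shows "(mu i j :: _ \<Rightarrow>\<^sub>0 'k::comm_ring_1) = (if i = 0 then 0 else node (S m11) [mu (i - 1) j])
    + (\<Sum>(r, t, s, w) \<in> splits i j. smul (ksign (bin_sign (r, s) (t, w))) (node (S m02) [mu r s, mu t w]))"
proof (cases "j = 1")
  case True
  then have "splits i j = {}" by (auto simp: splits_def)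
  then show ?thesis using True assms by (subst mu.simps) simp
next
  case j: False
  show ?thesis
  proof (cases "i = 0")
    case True
    have "(ksign (bin_sign (0, p) (0, q)) :: 'k) = ksign (int p * (int q + 1))" for p q
      by (rule ksign_cong) (simp add: bin_sign_def mu_deg_def shift_bideg_def algebra_simps)
    then have "(\<Sum>(p, q) \<in> {(p, q). 1 \<le> p \<and> 1 \<le> q \<and> p + q = j}.
          smul (ksign (int p * (int q + 1))) (node (S m02) [mu 0 p, mu 0 q :: _ \<Rightarrow>\<^sub>0 'k]))
      = (\<Sum>(r, t, s, w) \<in> splits i j. smul (ksign (bin_sign (r, s) (t, w))) (node (S m02) [mu r s, mu t w]))"
      by (intro sum.reindex_bij_witness[of _ "\<lambda>(r, t, s, w). (s, w)" "\<lambda>(p, q). (0, 0, p, q)"])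
        (auto simp: splits_def True)
    then show ?thesis using True j assms by (subst mu.simps) simp
  next
    case False
    then show ?thesis using j assms by (subst mu.simps) (simp add: splits_def bin_sign_def)
  qed
qed

text \<open>The root of a tree and the types of its subtrees select at most one summand of the
  recursion, and \<open>eps\<close> obeys the same recursion as the signs.\<close>

lemma lookup_mu:
  "Poly_Mapping.lookup (mu i j) t = (if dtree t \<and> nb t = i \<and> leaves t = j then eps t else 0)"
proof (induction "i + j" arbitrary: i j t rule: less_induct)
  case less
  consider "j = 0" | "(i, j) = (0, 1)" | "1 \<le> j" "(i, j) \<noteq> (0, 1)"
    by fastforce
  then show ?case
  proof cases
    case 1
    then show ?thesis using leaves_pos[of t] by (subst mu.simps) auto
  next
    case 2
    then show ?thesis using ty_01[of t] by (subst mu.simps) (auto simp: lookup_single when_def)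
  next
    case 3
    note [simp] = mu_rec[OF 3] lookup_add lookup_sum_pm lookup_node case_prod_beta
    consider "t = Leaf" | u where "t = un u" | u w where "t = bin u w"
      | "\<not> dtree t" "\<And>u. t \<noteq> un u" "\<And>u w. t \<noteq> bin u w"
      by (metis dtree.cases)
    then show ?thesis
    proof cases
      case 1
      then show ?thesis using 3(2) by auto
    next
      case (2 u)
      show ?thesis
      proof (cases "i = 0")
        case True
        then show ?thesis using mu_rec[OF 3, where 'k = 'a] by (simp add: 2)
      next
        case False
        then have "Poly_Mapping.lookup (mu (i - 1) j :: _ \<Rightarrow>\<^sub>0 'a) u
            = (if dtree u \<and> nb u = i - 1 \<and> leaves u = j then eps u else 0)"
          by (intro less) simp
        then show ?thesis using False by (auto simp: 2)
      qed
    next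
      case (3 u w)
      define f :: "nat \<times> nat \<times> nat \<times> nat \<Rightarrow> 'a" where
        "f = (\<lambda>(r, t, s, q). ksign (bin_sign (r, s) (t, q))
           * (Poly_Mapping.lookup (mu r s) u * Poly_Mapping.lookup (mu t q) w))"
      have f: "f (r, p, s, q) = (if dtree u \<and> dtree w \<and> ty u = (r, s) \<and> ty w = (p, q)
          then eps (bin u w) else 0)"
        if "(r, p, s, q) \<in> splits i j" for r p s q
      proof -
        have "Poly_Mapping.lookup (mu r s :: _ \<Rightarrow>\<^sub>0 'a) u
            = (if dtree u \<and> nb u = r \<and> leaves u = s then eps u else 0)"
          "Poly_Mapping.lookup (mu p q :: _ \<Rightarrow>\<^sub>0 'a) w
            = (if dtree w \<and> nb w = p \<and> leaves w = q then eps w else 0)"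
          using that by (intro less; auto simp: splits_def)+
        then show ?thesis by (auto simp: f_def ac_simps)
      qed
      have "Poly_Mapping.lookup (mu i j) t = sum f (splits i j)"
        by (simp add: 3 f_def)
      also have "\<dots> = (if dtree t \<and> nb t = i \<and> leaves t = j then eps t else 0)"
      proof (cases "dtree t \<and> nb t = i \<and> leaves t = j")
        case True
        \<comment> \<open>The only splitting for which both factors can have a nonzero coefficient
          at \<open>u\<close> and \<open>w\<close>.\<close>
        let ?x = "(nb u, nb w, leaves u, leaves w)"
        have x: "?x \<in> splits i j"
          using True leaves_pos[of u] leaves_pos[of w] by (simp add: 3 splits_def)
        have "f x = 0" if "x \<in> splits i j - {?x}" for x
        proof -
          obtain r p s q where "x = (r, p, s, q)" by (cases x)
          then show ?thesis using that f[of r p s q] by auto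
        qed
        then have "sum f (splits i j) = sum f {?x}"
          using x by (intro sum.mono_neutral_right) auto
        also have "\<dots> = eps t"
          using f[OF x] True by (simp add: 3)
        finally show ?thesis using True by simp
      next
        case False
        have "f x = 0" if "x \<in> splits i j" for x
        proof -
          obtain r p s q where x: "x = (r, p, s, q)" by (cases x)
          have "\<not> (dtree u \<and> dtree w \<and> ty u = (r, s) \<and> ty w = (p, q))"
            using False that by (auto simp: x 3 splits_def)
          then show ?thesis using f[of r p s q] that by (auto simp: x)
        qed
        then show ?thesis using False by auto
      qed
      finally show ?thesis .
    next
      case 4
      have "Poly_Mapping.lookup (node (S m11) [x]) t = 0"
        "Poly_Mapping.lookup (node (S m02) [x, y]) t = 0" for x y :: "_ \<Rightarrow>\<^sub>0 'a"
        using 4 by (auto split: tree.split simp: Suc_length_conv length_Suc_conv)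
      then show ?thesis using 4(1) by (simp del: lookup_node)
    qed
  qed
qed

section \<open>Grafting and the decomposition of a single tree\<close>

fun graft :: "'x tree \<Rightarrow> 'x tree list \<Rightarrow> 'x tree"
  and grafts :: "'x tree list \<Rightarrow> 'x tree list \<Rightarrow> 'x tree list" where
  "graft Leaf ts = hd ts"
| "graft (Node v us) ts = Node v (grafts us ts)"
| "grafts [] ts = []"
| "grafts (u # us) ts = graft u (take (leaves u) ts) # grafts us (drop (leaves u) ts)"

lemma graft_props:
  assumes "dtree u" "length ts = leaves u"
  shows "nb (graft u ts) = nb u + sum_list (map nb ts)"
    and "leaves (graft u ts) = sum_list (map leaves ts)"
    and "dtree (graft u ts) \<longleftrightarrow> (\<forall>t\<in>set ts. dtree t)"
proof -
  have "nb (graft u ts) = nb u + sum_list (map nb ts) \<and> leaves (graft u ts) = sum_list (map leaves ts)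
     \<and> (dtree (graft u ts) \<longleftrightarrow> (\<forall>t\<in>set ts. dtree t))"
    using assms
  proof (induction arbitrary: ts rule: dtree.induct)
    case Leaf
    then show ?case by (auto simp: length_Suc_conv)
  next
    case (un t)
    then show ?case by simp
  next
    case (bin t u)
    define xs ys where "xs = take (leaves t) ts" and "ys = drop (leaves t) ts"
    have ts: "ts = xs @ ys" "length xs = leaves t" "length ys = leaves u"
      using bin.prems by (simp_all add: xs_def ys_def)
    show ?case using bin.IH(1)[OF ts(2)] bin.IH(2)[OF ts(3)] by (auto simp: ts)
  qed
  then show "nb (graft u ts) = nb u + sum_list (map nb ts)"
    "leaves (graft u ts) = sum_list (map leaves ts)"
    "dtree (graft u ts) \<longleftrightarrow> (\<forall>t\<in>set ts. dtree t)"
    by blast+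
qed

lemma deco_sign_1: "deco_sign V [d] = 1"
proof -
  have "{0<..<Suc 0} = {}" by auto
  then show ?thesis by (simp add: deco_sign_def)
qed

lemma deco_sign_2:
  "deco_sign V [d, e] = ksign (bdot (sum_list (map (tdeg V) (snd d))) (tdeg V (fst e)))"
proof -
  have "{..<Suc (Suc 0)} = {0, 1}" "{0<..<Suc (Suc 0)} = {1}" "{Suc 0<..<Suc (Suc 0)} = {}"
    by auto
  then show ?thesis by (simp add: deco_sign_def)
qed

lemma sum_list_tdeg:
  "\<forall>t\<in>set ts. dtree t \<Longrightarrow> sum_list (map (tdeg sM_dAs) ts) = (\<Sum>(p, q)\<leftarrow>map ty ts. mu_deg p q)"
  by (induction ts) (auto simp: tdeg_dtree)

text \<open>The sign identity behind the binary case of the decomposition: the Koszul sign of moving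
  the left grafted trees past the right upper part accounts for joining the two lists and for the
  \<open>bin_sign\<close> of the root before and after grafting.\<close>

lemma X_graft_bin:
  assumes "dtree u" "dtree w" "length xs = leaves u" "length ys = leaves w"
    "\<forall>t\<in>set xs. dtree t" "\<forall>t\<in>set ys. dtree t"
  shows "even (bdot (sum_list (map (tdeg sM_dAs) xs)) (tdeg sM_dAs w) + X (map ty xs) + X (map ty ys)
     - (X (map ty (xs @ ys)) + bin_sign (ty u) (ty w) + bin_sign (ty (graft u xs)) (ty (graft w ys))))"
    (is "even ?d")
proof -
  obtain P1 Q1 P2 Q2 where s: "sum_list (map nb xs) = P1" "sum_list (map leaves xs) = Q1"
     "sum_list (map nb ys) = P2" "sum_list (map leaves ys) = Q2" by blast
  obtain i1 j1 i2 j2 where t: "nb u = i1" "leaves u = j1" "nb w = i2" "leaves w = j2" by blast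
  have s': "sum_list (map fst (map ty xs)) = P1" "sum_list (map snd (map ty xs)) = Q1"
     "sum_list (map fst (map ty ys)) = P2" "sum_list (map snd (map ty ys)) = Q2"
    by (simp_all add: s comp_def)
  have l: "length (map ty xs) = j1" "length (map ty ys) = j2"
    using assms(3,4) t by simp_all
  \<comment> \<open>After \<open>X_append\<close> the values of \<open>X\<close> on the two parts
    cancel. What remains is a polynomial in the types of \<open>u\<close> and \<open>w\<close> and
    the totals over \<open>xs\<close> and \<open>ys\<close>; the bracket is half of it.\<close>
  have "?d = 2 * (int j1 - int j1 * i2 - int j1 * j2 + int P1 * j2 + int Q1 * j2 - 2 * int P1 * P2
      - 2 * int P1 * Q2 - int Q1 * P2 - int Q1 * Q2 - 2 * int i1 * i2 + i1 - int i1 * j2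
      - int i1 * P2 - int i1 * Q2)"
    unfolding sum_list_tdeg[OF assms(5)] map_append X_append tdeg_dtree[OF assms(2)]
    unfolding sum_list_mu_deg bin_sign_def graft_props[OF assms(1,3)] graft_props[OF assms(2,4)]
      fst_conv snd_conv s s' l t mu_deg_def shift_bideg_def add_Pair bdot.simps
    by (simp add: algebra_simps)
  then show ?thesis by simp
qed

lemma lookup_lin_relabel_zero:
  assumes "\<And>a. g a \<noteq> b"
  shows "Poly_Mapping.lookup (lin (\<lambda>a. smul (c a) (bas (g a))) x) b = 0"
  using assms by (auto intro!: lookup_lin_zero simp: lookup_single)

lemma tdeco_un: "tdeco sM_dAs (un t) = bas (Leaf, [un t])
    + lin (\<lambda>d. bas (un (fst d), snd d)) (tdeco sM_dAs t)"
  by (simp add: lin_lin deco_sign_1)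

lemma tdeco_bin: "tdeco sM_dAs (bin t t') = bas (Leaf, [bin t t'])
    + lin (\<lambda>d. lin (\<lambda>e. smul (deco_sign sM_dAs [d, e]) (bas (bin (fst d) (fst e), snd d @ snd e)))
        (tdeco sM_dAs t')) (tdeco sM_dAs t)"
  by (simp add: lin_lin)

text \<open>Each way of cutting \<open>t\<close> into a lower tree \<open>u\<close> and trees
  \<open>ts\<close> over its leaves gives one term. Either \<open>u\<close> is trivial, or it shares
  its root with \<open>t\<close> and the cut restricts to the subtrees; \<open>X_graft_bin\<close>
  then combines their signs.\<close>

lemma lookup_tdeco:
  assumes "dtree t"
  shows "Poly_Mapping.lookup (tdeco sM_dAs t) (u, ts) =
    (if dtree u \<and> length ts = leaves u \<and> graft u ts = t
     then ksign (X (map ty ts)) * eps u * prod_list (map eps ts) * eps t else 0 :: 'k::comm_ring_1)"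
  using assms
proof (induction arbitrary: u ts rule: dtree.induct)
  case Leaf
  have "dtree u \<and> length ts = leaves u \<and> graft u ts = Leaf \<longleftrightarrow> u = Leaf \<and> ts = [Leaf]"
  proof
    assume *: "dtree u \<and> length ts = leaves u \<and> graft u ts = Leaf"
    then have "dtree u" by blast
    then show "u = Leaf \<and> ts = [Leaf]"
      using * by cases (auto simp: length_Suc_conv)
  qed auto
  then show ?case by (auto simp: lookup_single X_Cons when_def)
next
  case (un t)
  consider "u = Leaf" | u1 where "u = un u1" | "u \<noteq> Leaf" "\<And>t. u \<noteq> un t"
    by metis
  then show ?case
  proof cases
    case 1
    have "Poly_Mapping.lookup (lin (\<lambda>d. bas (un (fst d), snd d)) (tdeco sM_dAs t)) (Leaf, ts) = (0::'k)"
      by (auto intro!: lookup_lin_zero simp: lookup_single)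
    moreover have "length ts = leaves Leaf \<and> graft Leaf ts = un t \<longleftrightarrow> ts = [un t]"
      by (auto simp: length_Suc_conv)
    ultimately show ?thesis using un.hyps
      by (auto simp: 1 tdeco_un lookup_add lookup_single X_Cons simp del: eps.simps(2) tdeco.simps(2))
  next
    case (2 u1)
    have "Poly_Mapping.lookup (lin (\<lambda>d. bas (un (fst d), snd d)) (tdeco sM_dAs t)) (u, ts)
       = Poly_Mapping.lookup (tdeco sM_dAs t :: _ \<Rightarrow>\<^sub>0 'k) (u1, ts)
          * Poly_Mapping.lookup (bas (un (fst (u1, ts)), snd (u1, ts))) (u, ts)"
      by (rule lookup_lin_unique) (auto simp: lookup_single 2)
    then show ?thesis
      by (auto simp: 2 tdeco_un lookup_add lookup_single un.IH simp del: tdeco.simps(2))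
  next
    case 3
    have "Poly_Mapping.lookup (lin (\<lambda>d. bas (un (fst d), snd d)) (tdeco sM_dAs t)) (u, ts) = (0::'k)"
      by (auto intro!: lookup_lin_zero simp: lookup_single 3 3(2)[symmetric])
    moreover have "\<not> (dtree u \<and> graft u ts = un t)"
    proof
      assume *: "dtree u \<and> graft u ts = un t"
      then have "dtree u" by blast
      then show False using 3 * by cases auto
    qed
    ultimately show ?thesis
      using 3 by (auto simp: tdeco_un lookup_add lookup_single simp del: tdeco.simps(2))
  qed
next
  case (bin t t')
  let ?L = "\<lambda>d. lin (\<lambda>e. smul (deco_sign sM_dAs [d, e]) (bas (bin (fst d) (fst e), snd d @ snd e)))
        (tdeco sM_dAs t') :: _ \<Rightarrow>\<^sub>0 'k"
  consider "u = Leaf" | u1 u2 where "u = bin u1 u2" | "u \<noteq> Leaf" "\<And>t t'. u \<noteq> bin t t'"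
    by metis
  then show ?case
  proof cases
    case 1
    have "Poly_Mapping.lookup (lin ?L (tdeco sM_dAs t)) (Leaf, ts) = 0"
      by (auto intro!: lookup_lin_zero simp: lookup_single)
    moreover have "length ts = leaves Leaf \<and> graft Leaf ts = bin t t' \<longleftrightarrow> ts = [bin t t']"
      by (auto simp: length_Suc_conv)
    ultimately show ?thesis using bin.hyps
      by (auto simp: 1 tdeco_bin lookup_add lookup_single X_Cons simp del: eps.simps(2) tdeco.simps(2))
  next
    case (2 u1 u2)
    \<comment> \<open>The trees grafted onto the left and onto the right subtree of
      \<open>u\<close>.\<close>
    define xs ys where "xs = take (leaves u1) ts" and "ys = drop (leaves u1) ts"
    have ts: "ts = xs @ ys" by (simp add: xs_def ys_def)
    let ?ok1 = "dtree u1 \<and> length xs = leaves u1 \<and> graft u1 xs = t"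
    let ?ok2 = "dtree u2 \<and> length ys = leaves u2 \<and> graft u2 ys = t'"
    have inner: "Poly_Mapping.lookup (?L (u1, xs)) (u, ts)
        = Poly_Mapping.lookup (tdeco sM_dAs t') (u2, ys) * deco_sign sM_dAs [(u1, xs), (u2, ys)]"
    proof -
      have "Poly_Mapping.lookup (?L (u1, xs)) (u, ts)
        = Poly_Mapping.lookup (tdeco sM_dAs t') (u2, ys)
          * Poly_Mapping.lookup (smul (deco_sign sM_dAs [(u1, xs), (u2, ys)])
            (bas (bin (fst (u1, xs)) (fst (u2, ys)), snd (u1, xs) @ snd (u2, ys)))) (u, ts)"
        by (rule lookup_lin_unique) (auto simp: lookup_single when_def 2 ts split: if_splits)
      then show ?thesis by (simp add: 2 ts)
    qed
    have "Poly_Mapping.lookup (lin ?L (tdeco sM_dAs t)) (u, ts)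
      = Poly_Mapping.lookup (tdeco sM_dAs t) (u1, xs) * Poly_Mapping.lookup (?L (u1, xs)) (u, ts)"
    proof (rule lookup_lin_unique)
      fix d :: "dAs_gen shifted tree \<times> dAs_gen shifted tree list"
      assume "Poly_Mapping.lookup (tdeco sM_dAs t) d \<noteq> (0::'k)" and d: "d \<noteq> (u1, xs)"
      \<comment> \<open>The length of the list is forced by the first component, so a concatenation
        equal to \<open>ts\<close> can be split in one way only.\<close>
      then have "length (snd d) = leaves (fst d)"
        by (cases d) (auto simp: bin.IH split: if_splits)
      then have "fst d \<noteq> u1 \<or> (\<forall>zs. ts \<noteq> snd d @ zs)"
        using d by (cases d) (auto simp: xs_def)
      then show "Poly_Mapping.lookup (?L d) (u, ts) = 0"
        by (intro lookup_lin_relabel_zero) (auto simp: 2)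
    qed
    then have *: "Poly_Mapping.lookup (tdeco sM_dAs (bin t t')) (u, ts) =
       Poly_Mapping.lookup (tdeco sM_dAs t) (u1, xs) *
         (Poly_Mapping.lookup (tdeco sM_dAs t') (u2, ys) * (deco_sign sM_dAs [(u1, xs), (u2, ys)] :: 'k))"
      unfolding inner tdeco_bin by (simp add: lookup_add lookup_single 2)
    show ?thesis
    proof (cases "?ok1 \<and> ?ok2")
      case True
      then have ok: "dtree u \<and> length ts = leaves u \<and> graft u ts = bin t t'"
        by (simp add: 2 ts)
      have "\<forall>t\<in>set xs. dtree t" "\<forall>t\<in>set ys. dtree t"
        using True bin.hyps graft_props(3)[of u1 xs] graft_props(3)[of u2 ys] by auto
      then have "ksign (bdot (sum_list (map (tdeg sM_dAs) xs)) (tdeg sM_dAs u2)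
            + X (map ty xs) + X (map ty ys))
        = (ksign (X (map ty ts) + bin_sign (ty u1) (ty u2) + bin_sign (ty t) (ty t')) :: 'k)"
        using True X_graft_bin[of u1 u2 xs ys] by (intro ksign_cong) (auto simp: ts)
      then have sgn: "deco_sign sM_dAs [(u1, xs), (u2, ys)] * (ksign (X (map ty xs)) * ksign (X (map ty ys)))
         = ksign (X (map ty ts)) * (ksign (bin_sign (ty u1) (ty u2)) * (ksign (bin_sign (ty t) (ty t')) :: 'k))"
        unfolding deco_sign_2 ksign_add by (simp add: ac_simps)
      have "Poly_Mapping.lookup (tdeco sM_dAs (bin t t')) (u, ts)
        = (deco_sign sM_dAs [(u1, xs), (u2, ys)] * (ksign (X (map ty xs)) * ksign (X (map ty ys))))
          * (eps u1 * eps u2 * eps t * eps t' * prod_list (map eps ts) :: 'k)"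
        unfolding * bin.IH using True by (simp add: ts ac_simps)
      also have "\<dots> = ksign (X (map ty ts)) * eps u * prod_list (map eps ts) * eps (bin t t')"
        unfolding sgn by (simp add: 2 ac_simps)
      finally show ?thesis using ok by simp
    next
      case False
      then have "\<not> (dtree u \<and> length ts = leaves u \<and> graft u ts = bin t t')"
        by (auto simp: 2 xs_def ys_def)
      then show ?thesis
        unfolding * using False by (simp only: bin.IH) auto
    qed
  next
    case 3
    have "Poly_Mapping.lookup (lin ?L (tdeco sM_dAs t)) (u, ts) = 0"
      by (auto intro!: lookup_lin_zero simp: lookup_single 3 3(2)[symmetric])
    moreover have "\<not> (dtree u \<and> graft u ts = bin t t')"
    proof
      assume *: "dtree u \<and> graft u ts = bin t t'"
      then have "dtree u" by blast
      then show False using 3 * by cases auto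
    qed
    ultimately show ?thesis
      using 3 by (auto simp: tdeco_bin lookup_add lookup_single simp del: tdeco.simps(2))
  qed
qed


section \<open>The decomposition of \<open>\<mu>\<^sub>u\<^sub>v\<close>\<close>

lemma cofree_sM_iff:
  "x \<in> cofree (sM_dAs :: (_, 'k::comm_ring_1) coll) n
     \<longleftrightarrow> (\<forall>t. Poly_Mapping.lookup x t \<noteq> 0 \<longrightarrow> dtree t \<and> leaves t = n)"
  by (auto simp: cofree_def dtree_iff_wf_tree[where 'k = 'k] in_keys_iff)

text \<open>Only the tree \<open>graft u ts\<close> contributes to the coefficient at
  \<open>(u, ts)\<close>. Hence this coefficient and the one of \<open>x\<close> at that tree
  determine each other up to a known sign.\<close>

lemma lookup_cofree_deco:
  assumes "x \<in> cofree sM_dAs n"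
  shows "Poly_Mapping.lookup (cofree_deco sM_dAs x) (u, ts) =
    (if dtree u \<and> length ts = leaves u \<and> (\<forall>t\<in>set ts. dtree t)
     then Poly_Mapping.lookup x (graft u ts) *
       (ksign (X (map ty ts)) * eps u * prod_list (map eps ts) * eps (graft u ts))
     else 0 :: 'k::comm_ring_1)"
proof -
  have d: "dtree t" if "Poly_Mapping.lookup x t \<noteq> 0" for t
    using assms that by (auto simp: cofree_sM_iff)
  have "Poly_Mapping.lookup (cofree_deco sM_dAs x) (u, ts) =
      Poly_Mapping.lookup x (graft u ts) * Poly_Mapping.lookup (tdeco sM_dAs (graft u ts)) (u, ts)"
    unfolding cofree_deco_def
    by (rule lookup_lin_unique) (auto simp: lookup_tdeco d)
  then show ?thesis
    using graft_props(3)[of u ts] d[of "graft u ts"]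
    by (cases "Poly_Mapping.lookup x (graft u ts) = 0") (auto simp: lookup_tdeco)
qed

lemma mu_in_cofree: "mu i n \<in> cofree sM_dAs n"
  by (auto simp: cofree_sM_iff lookup_mu)

lemma lookup_tens_mu:
  "Poly_Mapping.lookup (tens (map (\<lambda>(p, q). mu p q) ps)) ts
     = (if (\<forall>t\<in>set ts. dtree t) \<and> map ty ts = ps then prod_list (map eps ts) else 0 :: 'k::comm_ring_1)"
proof (induction ps arbitrary: ts)
  case Nil
  then show ?case by (auto simp: lookup_single when_def)
next
  case (Cons pq ps)
  show ?case
  proof (cases ts)
    case Nil
    then show ?thesis by (simp add: lookup_tens del: tens.simps)
  next
    case (Cons t ts')
    have "Poly_Mapping.lookup (tens (map (\<lambda>(p, q). mu p q) (pq # ps))) ts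
       = Poly_Mapping.lookup (mu (fst pq) (snd pq)) t
         * Poly_Mapping.lookup (tens (map (\<lambda>(p, q). mu p q) ps) :: _ \<Rightarrow>\<^sub>0 'k) ts'"
      by (simp add: lookup_tens Cons case_prod_beta del: tens.simps)
    then show ?thesis
      unfolding Cons.IH lookup_mu by (cases pq) (auto simp: Cons simp del: tens.simps)
  qed
qed

text \<open>Arities are at least 1, so their sum bounds the length of the list.\<close>

lemma finite_deco_index: "finite (deco_index u v)"
proof (rule finite_subset)
  have "length ps \<le> sum_list (map snd ps)" if "\<forall>(p, q)\<in>set ps. 1 \<le> q" for ps :: "(nat \<times> nat) list"
    using that by (induction ps) auto
  moreover have "p \<le> sum_list (map fst ps)" "q \<le> sum_list (map snd ps)" if "(p, q) \<in> set ps"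
    for p q and ps :: "(nat \<times> nat) list"
    using that by (force intro!: member_le_sum_list)+
  ultimately show "deco_index u v \<subseteq> {..u} \<times> {ps. set ps \<subseteq> {..u} \<times> {..v} \<and> length ps \<le> v}"
    unfolding deco_index_def by fastforce
  show "finite ({..u} \<times> {ps. set ps \<subseteq> {..u} \<times> {..v} \<and> length ps \<le> v})"
    by (intro finite_cartesian_product finite_lists_length_le) auto
qed

text \<open>Both sides are compared at \<open>(w, ts)\<close>: on the right only the index formed by
  the types of \<open>w\<close> and \<open>ts\<close> counts, on the left only the tree
  \<open>graft w ts\<close>.\<close>

lemma cofree_deco_mu:
  "cofree_deco sM_dAs (mu u v :: _ \<Rightarrow>\<^sub>0 'k::comm_ring_1)
     = (\<Sum>(i, ps) \<in> deco_index u v.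
          smul (ksign (X ps)) (tens2 (mu i (length ps)) (tens (map (\<lambda>(p, q). mu p q) ps))))"
proof (rule poly_mapping_eqI, clarify)
  fix w ts
  let ?x = "(nb w, map ty ts)"
  let ?ok = "dtree w \<and> length ts = leaves w \<and> (\<forall>t\<in>set ts. dtree t)"
  let ?c = "ksign (X (map ty ts)) * eps w * prod_list (map eps ts) :: 'k"
  define f :: "nat \<times> (nat \<times> nat) list \<Rightarrow> 'k" where
    "f = (\<lambda>(i, ps). ksign (X ps) * (Poly_Mapping.lookup (mu i (length ps)) w
       * Poly_Mapping.lookup (tens (map (\<lambda>(p, q). mu p q) ps)) ts))"
  have f: "f x = (if ?ok \<and> x = ?x then ?c else 0)" for x
    unfolding f_def by (cases x) (auto simp: lookup_mu lookup_tens_mu)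
  have mem: "?x \<in> deco_index u v \<longleftrightarrow> nb (graft w ts) = u \<and> leaves (graft w ts) = v" if ?ok
  proof -
    \<comment> \<open>The index set asks for a nonempty list, which a tree with at least one leaf
      provides.\<close>
    have "ts \<noteq> []" using that leaves_pos[of w] by auto
    then show ?thesis using that by (auto simp: deco_index_def graft_props comp_def leaves_pos[simplified])
  qed
  have "Poly_Mapping.lookup (\<Sum>(i, ps) \<in> deco_index u v. smul (ksign (X ps))
      (tens2 (mu i (length ps)) (tens (map (\<lambda>(p, q). mu p q) ps)))) (w, ts) = sum f (deco_index u v)"
    by (simp add: lookup_sum_pm f_def case_prod_beta)
  also have "\<dots> = (if ?ok \<and> ?x \<in> deco_index u v then ?c else 0)"
  proof (cases ?ok)
    case True
    then show ?thesis by (simp add: f finite_deco_index)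
  next
    case False
    then have "f x = 0" for x by (auto simp: f)
    then show ?thesis using False by auto
  qed
  \<comment> \<open>The coefficient of \<open>mu u v\<close> at the grafted tree is its
    \<open>eps\<close>, which cancels against the same factor in the decomposition.\<close>
  also have "\<dots> = Poly_Mapping.lookup (cofree_deco sM_dAs (mu u v :: _ \<Rightarrow>\<^sub>0 'k)) (w, ts)"
    unfolding lookup_cofree_deco[OF mu_in_cofree] lookup_mu
    using mem graft_props(3)[of w ts] by (auto simp: ac_simps)
  finally show "Poly_Mapping.lookup (cofree_deco sM_dAs (mu u v :: _ \<Rightarrow>\<^sub>0 'k)) (w, ts)
    = Poly_Mapping.lookup (\<Sum>(i, ps) \<in> deco_index u v. smul (ksign (X ps))
      (tens2 (mu i (length ps)) (tens (map (\<lambda>(p, q). mu p q) ps)))) (w, ts)" by simp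
qed

text \<open>The generators have zero differential, and every other term has a vanishing subtree
  factor by induction.\<close>

lemma tdiff_sM_dAs: "tdiff sM_dAs t = (0 :: _ \<Rightarrow>\<^sub>0 'k::comm_ring_1)"
proof (induction t)
  case (Node v ts)
  have "node v ((map bas ts)[r := tdiff sM_dAs (ts ! r)]) = (0 :: _ \<Rightarrow>\<^sub>0 'k)" if "r < length ts" for r
    using that Node.IH[of "ts ! r"] by (intro node_zero) (simp add: set_update_memI)
  then show ?case by simp
qed simp

lemma cofree_diff_sM_dAs: "cofree_diff sM_dAs x = 0"
  by (simp add: cofree_diff_def tdiff_sM_dAs lin_def)

section \<open>The corelations and the span of the \<open>\<mu>\<^sub>i\<^sub>j\<close>\<close>

definition g_assoc :: "dAs_gen shifted tree \<Rightarrow>\<^sub>0 'k::comm_ring_1" where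
  "g_assoc = bas (bin (bin Leaf Leaf) Leaf) - bas (bin Leaf (bin Leaf Leaf))"

definition g_deriv :: "dAs_gen shifted tree \<Rightarrow>\<^sub>0 'k::comm_ring_1" where
  "g_deriv = bas (un (bin Leaf Leaf)) - bas (bin (un Leaf) Leaf) - bas (bin Leaf (un Leaf))"

text \<open>Both generators of \<open>M_dAs\<close> have second degree 0, so the double shift only
  relabels the three relations and brings in no sign.\<close>

lemma corelations_eq:
  "lin (shift2 M_dAs) ` R_dAs = fm_span {g_assoc, bas (un (un Leaf)), g_deriv :: _ \<Rightarrow>\<^sub>0 'k::comm_ring_1}"
proof -
  interpret module_hom smul smul "lin (shift2 M_dAs :: _ \<Rightarrow> _ \<Rightarrow>\<^sub>0 'k)"
    by (rule module_hom_lin)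
  have s: "lin (shift2 M_dAs) (pcomp (M_dAs :: (_, 'k) coll) v i w)
      = (shift2 M_dAs (Node v ((replicate (ar (M_dAs :: (_, 'k) coll) v) Leaf)
           [i - 1 := corolla (M_dAs :: (_, 'k) coll) w])) :: _ \<Rightarrow>\<^sub>0 'k)"
    for v i w
    by (simp add: pcomp_def)
  have [simp]: "ar M_dAs m02 = 2" "ar M_dAs m11 = 1" "bdeg M_dAs m02 = (0, 0)" "bdeg M_dAs m11 = (1, 0)"
    by (simp_all add: M_dAs_def)
  show ?thesis
    unfolding R_dAs_def fm_span_def span_image[symmetric]
    by (simp add: diff s corolla_def numeral_2_eq_2 g_assoc_def g_deriv_def)
qed

lemma vertices_2_iff:
  "dtree t \<and> vertices t = 2 \<longleftrightarrow> t \<in> {un (un Leaf), un (bin Leaf Leaf), bin (un Leaf) Leaf,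
     bin Leaf (un Leaf), bin (bin Leaf Leaf) Leaf, bin Leaf (bin Leaf Leaf)}"
proof
  have 0: "vertices t = 0 \<longleftrightarrow> t = Leaf" for t :: "dAs_gen shifted tree"
    by (cases t) auto
  have 1: "vertices t = Suc 0 \<longleftrightarrow> t = un Leaf \<or> t = bin Leaf Leaf" if "dtree t" for t
    using that by cases (auto simp: 0)
  assume *: "dtree t \<and> vertices t = 2"
  then have "dtree t" by blast
  then show "t \<in> {un (un Leaf), un (bin Leaf Leaf), bin (un Leaf) Leaf,
     bin Leaf (un Leaf), bin (bin Leaf Leaf) Leaf, bin Leaf (bin Leaf Leaf)}"
    using * by cases (auto simp: 0 1 numeral_2_eq_2 add_is_1)
qed auto


text \<open>These are exactly the coefficients of the three generating corelations, one for each
  type of tree with two vertices.\<close>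

lemma eps_vertices_2:
  "eps (un (un Leaf)) = 1" "eps (un (bin Leaf Leaf)) = 1" "eps (bin (un Leaf) Leaf) = - 1"
  "eps (bin Leaf (un Leaf)) = - 1" "eps (bin (bin Leaf Leaf) Leaf) = 1"
  "eps (bin Leaf (bin Leaf Leaf)) = - 1"
  by (simp_all add: bin_sign_def mu_deg_def shift_bideg_def ksign_def)

text \<open>By linearity it suffices to look at the generators: the coefficients of each are the
  values of \<open>eps\<close> on one type and 0 elsewhere.\<close>

lemma corelation_coherent:
  assumes "y \<in> lin (shift2 M_dAs) ` R_dAs"
    and "dtree t" "dtree t'" "vertices t = 2" "vertices t' = 2" "ty t = ty t'"
  shows "eps t * Poly_Mapping.lookup y t = eps t' * (Poly_Mapping.lookup y t' :: 'k::comm_ring_1)"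
  using assms(1) unfolding corelations_eq
proof (induction rule: fm.span_induct_alt)
  case (step c x y)
  have "t \<in> {un (un Leaf), un (bin Leaf Leaf), bin (un Leaf) Leaf,
     bin Leaf (un Leaf), bin (bin Leaf Leaf) Leaf, bin Leaf (bin Leaf Leaf)}"
    "t' \<in> {un (un Leaf), un (bin Leaf Leaf), bin (un Leaf) Leaf,
     bin Leaf (un Leaf), bin (bin Leaf Leaf) Leaf, bin Leaf (bin Leaf Leaf)}"
    using vertices_2_iff[of t] vertices_2_iff[of t'] assms by blast+
  then have "eps t * Poly_Mapping.lookup x t = eps t' * Poly_Mapping.lookup x t'"
    using step(1) assms(6)
    by (auto simp: g_assoc_def g_deriv_def eps_vertices_2 lookup_minus lookup_single simp del: eps.simps(2))
  then have "c * (eps t * Poly_Mapping.lookup x t) = c * (eps t' * Poly_Mapping.lookup x t')"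
    by simp
  then show ?case using step(2) by (simp add: lookup_add algebra_simps)
qed simp

lemma corelationI:
  fixes y :: "_ \<Rightarrow>\<^sub>0 'k::comm_ring_1"
  assumes supp: "\<And>t. Poly_Mapping.lookup y t \<noteq> 0 \<Longrightarrow> dtree t \<and> vertices t = 2"
    and coh: "\<And>t t'. dtree t \<Longrightarrow> dtree t' \<Longrightarrow> ty t = ty t' \<Longrightarrow>
      eps t * Poly_Mapping.lookup y t = eps t' * Poly_Mapping.lookup y t'"
  shows "y \<in> lin (shift2 M_dAs) ` R_dAs"
proof -
  have eq: "Poly_Mapping.lookup y (bin Leaf (bin Leaf Leaf)) = - Poly_Mapping.lookup y (bin (bin Leaf Leaf) Leaf)"
    "Poly_Mapping.lookup y (bin (un Leaf) Leaf) = - Poly_Mapping.lookup y (un (bin Leaf Leaf))"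
    "Poly_Mapping.lookup y (bin Leaf (un Leaf)) = - Poly_Mapping.lookup y (un (bin Leaf Leaf))"
    using coh[of "bin (bin Leaf Leaf) Leaf" "bin Leaf (bin Leaf Leaf)"]
      coh[of "un (bin Leaf Leaf)" "bin (un Leaf) Leaf"] coh[of "un (bin Leaf Leaf)" "bin Leaf (un Leaf)"]
    unfolding eps_vertices_2 by simp_all
  \<comment> \<open>In each type a tree with \<open>eps\<close> equal to 1 serves as representative.
    Its coefficient in \<open>y\<close> is the factor of the generator, and coherence fixes the
    other coefficients.\<close>
  have "y = smul (Poly_Mapping.lookup y (bin (bin Leaf Leaf) Leaf)) g_assoc
     + smul (Poly_Mapping.lookup y (un (un Leaf))) (bas (un (un Leaf)))
     + smul (Poly_Mapping.lookup y (un (bin Leaf Leaf))) g_deriv" (is "_ = ?r")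
  proof (rule poly_mapping_eqI)
    fix t
    show "Poly_Mapping.lookup y t = Poly_Mapping.lookup ?r t"
    proof (cases "dtree t \<and> vertices t = 2")
      case True
      then show ?thesis unfolding vertices_2_iff
        by (auto simp: g_assoc_def g_deriv_def lookup_add lookup_minus lookup_single eq)
    next
      case False
      then have "Poly_Mapping.lookup y t = 0" using supp by blast
      moreover have "Poly_Mapping.lookup ?r t = 0" using False unfolding vertices_2_iff
        by (auto simp: g_assoc_def g_deriv_def lookup_add lookup_minus lookup_single when_def)
      ultimately show ?thesis by simp
    qed
  qed
  then show ?thesis
    unfolding corelations_eq
    by (metis (no_types, lifting) fm.span_add fm.span_base fm.span_scale insertCI)
qed

section \<open>The span of the \<open>mu i j\<close> as a sub-cooperad satisfying the
  corelations\<close>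

definition mu_span :: "nat \<Rightarrow> (dAs_gen shifted tree \<Rightarrow>\<^sub>0 'k::comm_ring_1) set" where
  "mu_span n = fm_span (range (\<lambda>i. mu i n))"

lemma mu_span_induct [consumes 1, case_names zero step]:
  assumes "x \<in> mu_span n" "h 0" "\<And>c i y. h y \<Longrightarrow> h (smul c (mu i n) + y)"
  shows "h x"
  using assms(1) unfolding mu_span_def
  by (induction rule: fm.span_induct_alt) (auto intro: assms)

lemma mu_in_mu_span: "mu i n \<in> mu_span n"
  unfolding mu_span_def by (intro fm.span_base) auto

lemma mu_0_right: "mu i 0 = 0"
  by (subst mu.simps) simp

lemma mu_span_0: "mu_span 0 = {0}"
  by (simp add: mu_span_def mu_0_right)

lemma subspace_mu_span: "fm_subspace (mu_span n)"
  unfolding mu_span_def by (rule fm.subspace_span)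

lemma mu_span_subset_cofree: "mu_span n \<subseteq> cofree sM_dAs n"
proof
  fix x :: "_ \<Rightarrow>\<^sub>0 'k::comm_ring_1"
  assume "x \<in> mu_span n"
  then show "x \<in> cofree sM_dAs n"
  proof (induction rule: mu_span_induct)
    case (step c i y)
    have "dtree t \<and> leaves t = n" if "c * Poly_Mapping.lookup (mu i n) t + Poly_Mapping.lookup y t \<noteq> 0" for t
      using that step by (cases "Poly_Mapping.lookup y t = 0") (auto simp: cofree_sM_iff lookup_mu split: if_splits)
    then show ?case by (simp add: cofree_sM_iff lookup_add)
  qed (simp add: cofree_sM_iff)
qed

lemma restr_tdeg_mu: "restr (\<lambda>t. tdeg (sM_dAs :: (_, 'k::comm_ring_1) coll) t = b) (mu i n :: _ \<Rightarrow>\<^sub>0 'k)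
   = (if b = mu_deg i n then mu i n else 0)"
  by (rule poly_mapping_eqI) (auto simp: lookup_mu tdeg_dtree)

text \<open>The summands in the formula for the decomposition are multiples of generators of
  \<open>circ\<close>, with \<open>map snd ps\<close> as the list of arities.\<close>

lemma cofree_deco_mu_in_circ: "cofree_deco sM_dAs (mu i n) \<in> circ mu_span n"
proof (cases "n = 0")
  case True
  then show ?thesis by (simp add: mu_0_right cofree_deco_def circ_def fm.span_zero)
next
  case False
  show ?thesis
    unfolding cofree_deco_mu circ_def
  proof (intro fm.span_sum, clarify, intro fm.span_scale fm.span_base CollectI exI conjI)
    fix k ps assume "(k, ps) \<in> deco_index i n"
    then show "sum_list (map snd ps) = n" by (auto simp: deco_index_def)
    show "mu k (length ps) \<in> mu_span (length (map snd ps))" by (simp add: mu_in_mu_span)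
    show "list_all2 (\<lambda>x m. x \<in> mu_span m) (map (\<lambda>(p, q). mu p q) ps) (map snd ps)"
      by (auto simp: list_all2_conv_all_nth mu_in_mu_span case_prod_beta)
  qed simp
qed

lemma subcooperad_mu_span: "subcooperad sM_dAs mu_span"
  unfolding subcooperad_def
proof (intro allI conjI ballI)
  fix n and x :: "_ \<Rightarrow>\<^sub>0 'k::comm_ring_1" and b
  show "mu_span n \<subseteq> cofree (sM_dAs :: (_, 'k) coll) n" by (rule mu_span_subset_cofree)
  show "fm_subspace (mu_span n :: (_ \<Rightarrow>\<^sub>0 'k) set)" by (rule subspace_mu_span)
  assume x: "x \<in> mu_span n"
  show "cofree_diff sM_dAs x \<in> mu_span n"
    using fm.subspace_0[OF subspace_mu_span] by (simp add: cofree_diff_sM_dAs)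
  from x show "restr (\<lambda>t. tdeg (sM_dAs :: (_, 'k) coll) t = b) x \<in> mu_span n"
  proof (induction rule: mu_span_induct)
    case zero
    then show ?case by (simp add: restr_def fm.subspace_0[OF subspace_mu_span])
  next
    case (step c i y)
    then show ?case
      by (auto simp: restr_add restr_smul restr_tdeg_mu mu_in_mu_span
        intro!: fm.subspace_add[OF subspace_mu_span] fm.subspace_scale[OF subspace_mu_span])
  qed
  from x show "cofree_deco sM_dAs x \<in> circ mu_span n"
  proof (induction rule: mu_span_induct)
    case zero
    then show ?case by (simp add: cofree_deco_def circ_def fm.span_zero)
  next
    case (step c i y)
    then show ?case
      using cofree_deco_mu_in_circ[of i n]
      unfolding cofree_deco_def lin_add lin_smul circ_def by (intro fm.span_add fm.span_scale)
  qed
qed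

lemma corelations_mu_span: "satisfies_corelations (lin (shift2 M_dAs) ` R_dAs) mu_span"
  unfolding satisfies_corelations_def
proof (intro allI ballI)
  fix n and x :: "_ \<Rightarrow>\<^sub>0 'k::comm_ring_1"
  assume "x \<in> mu_span n"
  then show "restr (\<lambda>t. vertices t = 2) x \<in> lin (shift2 M_dAs) ` R_dAs"
  proof (induction rule: mu_span_induct)
    case zero
    then show ?case unfolding corelations_eq by (simp add: restr_def fm.span_zero)
  next
    case (step c i y)
    have "restr (\<lambda>t. vertices t = 2) (mu i n :: _ \<Rightarrow>\<^sub>0 'k) \<in> lin (shift2 M_dAs) ` R_dAs"
    proof (rule corelationI)
      fix t t' :: "dAs_gen shifted tree"
      assume *: "dtree t" "dtree t'" "ty t = ty t'"
      \<comment> \<open>The type determines the number of vertices, so the restriction keeps or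
        removes both trees together.\<close>
      then have "vertices t = vertices t'"
        using vertices_dtree[of t] vertices_dtree[of t'] by simp
      then show "eps t * Poly_Mapping.lookup (restr (\<lambda>t. vertices t = 2) (mu i n :: _ \<Rightarrow>\<^sub>0 'k)) t
        = eps t' * Poly_Mapping.lookup (restr (\<lambda>t. vertices t = 2) (mu i n)) t'"
        using * by (simp add: lookup_mu)
    qed (auto simp: lookup_mu split: if_splits)
    then show ?case
      using step.IH unfolding corelations_eq by (simp add: restr_add restr_smul fm.span_add fm.span_scale)
  qed
qed


section \<open>Maximality\<close>

text \<open>Equality of types is included so that coherent trees have equally many leaves to graft
  on and yield the same value of \<open>X\<close> when grafted.\<close>

definition coherent :: "(nat \<Rightarrow> (dAs_gen shifted tree \<Rightarrow>\<^sub>0 'k::comm_ring_1) set) \<Rightarrow>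
    dAs_gen shifted tree \<Rightarrow> dAs_gen shifted tree \<Rightarrow> bool" where
  "coherent C t t' \<longleftrightarrow> dtree t \<and> dtree t' \<and> ty t = ty t' \<and>
     (\<forall>n. \<forall>x\<in>C n. eps t * Poly_Mapping.lookup x t = eps t' * Poly_Mapping.lookup x t')"

lemma coherent_refl: "dtree t \<Longrightarrow> coherent C t t"
  by (simp add: coherent_def)

lemma coherent_trans [trans]: "coherent C t u \<Longrightarrow> coherent C u w \<Longrightarrow> coherent C t w"
  by (simp add: coherent_def)

lemma prod_eps_square:
  "\<forall>t\<in>set ts. dtree t \<Longrightarrow> prod_list (map eps ts) * (prod_list (map eps ts) * x) = x"
  by (induction ts arbitrary: x) (auto simp: ac_simps)

lemma coherent_tens:
  fixes C :: "nat \<Rightarrow> (dAs_gen shifted tree \<Rightarrow>\<^sub>0 'k::comm_ring_1) set"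
  assumes "list_all2 (coherent C) ts ts'" "list_all2 (\<lambda>x m. x \<in> C m) cs ns"
  shows "prod_list (map eps ts) * Poly_Mapping.lookup (tens cs) ts
       = prod_list (map eps ts') * Poly_Mapping.lookup (tens cs) ts'"
  using assms
proof (induction ts ts' arbitrary: cs ns rule: list_all2_induct)
  case Nil
  then show ?case by simp
next
  case (Cons t ts t' ts')
  show ?case
  proof (cases cs)
    case Nil
    then show ?thesis by (simp add: lookup_tens del: tens.simps)
  next
    case (Cons c cs')
    then obtain m ns' where *: "c \<in> C m" "list_all2 (\<lambda>x m. x \<in> C m) cs' ns'"
      using Cons.prems by (auto simp: list_all2_Cons1)
    have l: "Poly_Mapping.lookup (tens cs) (t # ts) = Poly_Mapping.lookup c t * Poly_Mapping.lookup (tens cs') ts"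
      for t ts
      by (simp add: Cons lookup_tens del: tens.simps)
    have "eps t * Poly_Mapping.lookup c t = eps t' * Poly_Mapping.lookup c t'"
      using Cons.hyps(1) *(1) by (auto simp: coherent_def)
    then have "(eps t * Poly_Mapping.lookup c t) * (prod_list (map eps ts) * Poly_Mapping.lookup (tens cs') ts)
      = (eps t' * Poly_Mapping.lookup c t') * (prod_list (map eps ts') * Poly_Mapping.lookup (tens cs') ts')"
      using Cons.IH[OF *(2)] by simp
    then show ?thesis unfolding l by (simp add: ac_simps)
  qed
qed

text \<open>By linearity \<open>y\<close> may be taken to be a pure tensor of elements of
  \<open>C\<close>. Its coefficients are products, in which each tree can be replaced by a coherent
  one separately.\<close>

lemma coherent_circ:
  fixes C :: "nat \<Rightarrow> (dAs_gen shifted tree \<Rightarrow>\<^sub>0 'k::comm_ring_1) set"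
  assumes "y \<in> circ C n" "coherent C u u'" "list_all2 (coherent C) ts ts'"
  shows "eps u * (prod_list (map eps ts) * Poly_Mapping.lookup y (u, ts))
       = eps u' * (prod_list (map eps ts') * Poly_Mapping.lookup y (u', ts'))"
  using assms(1) unfolding circ_def
proof (induction rule: fm.span_induct_alt)
  case (step a x y)
  then obtain c cs ns where x: "x = tens2 c (tens cs)" "c \<in> C (length ns)"
    "list_all2 (\<lambda>x m. x \<in> C m) cs ns" by blast
  have "(eps u * Poly_Mapping.lookup c u) * (prod_list (map eps ts) * Poly_Mapping.lookup (tens cs) ts)
      = (eps u' * Poly_Mapping.lookup c u') * (prod_list (map eps ts') * Poly_Mapping.lookup (tens cs) ts')"
    using coherent_tens[OF assms(3) x(3)] assms(2) x(2) by (auto simp: coherent_def)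
  then have "a * ((eps u * Poly_Mapping.lookup c u) * (prod_list (map eps ts) * Poly_Mapping.lookup (tens cs) ts))
      = a * ((eps u' * Poly_Mapping.lookup c u') * (prod_list (map eps ts') * Poly_Mapping.lookup (tens cs) ts'))"
    by simp
  then have "eps u * (prod_list (map eps ts) * (a * Poly_Mapping.lookup x (u, ts)))
    = eps u' * (prod_list (map eps ts') * (a * Poly_Mapping.lookup x (u', ts')))"
    by (simp add: x(1) ac_simps)
  then show ?case using step(2) by (simp add: lookup_add distrib_left)
qed simp

text \<open>The coefficient of \<open>x\<close> at a grafted tree is read off from the decomposition
  of \<open>x\<close>, which lies in \<open>circ C n\<close>; there \<open>coherent_circ\<close>
  applies. The remaining sign depends on types only.\<close>

lemma coherent_graft:
  fixes C :: "nat \<Rightarrow> (dAs_gen shifted tree \<Rightarrow>\<^sub>0 'k::comm_ring_1) set"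
  assumes C: "subcooperad sM_dAs C"
    and u: "coherent C u u'" and ts: "list_all2 (coherent C) ts ts'" and len: "length ts = leaves u"
  shows "coherent C (graft u ts) (graft u' ts')"
proof -
  have d: "dtree u" "dtree u'" "\<forall>t\<in>set ts. dtree t" "\<forall>t\<in>set ts'. dtree t"
    and ty: "ty u = ty u'" and len': "length ts' = leaves u'"
    using u ts len by (auto simp: coherent_def list_all2_conv_all_nth in_set_conv_nth)
  have map_ty: "map ty ts = map ty ts'"
    using ts by (auto simp: coherent_def list_all2_conv_all_nth intro!: nth_equalityI)
  then have maps: "map nb ts = map nb ts'" "map leaves ts = map leaves ts'"
    by (induction ts ts' rule: list_induct2'; simp)+
  note g = graft_props[OF d(1) len] graft_props[OF d(2) len']
  have gd: "dtree (graft u ts)" "dtree (graft u' ts')" using g d by simp_all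
  \<comment> \<open>The formula of \<open>lookup_cofree_deco\<close> solved for the coefficient of
    \<open>x\<close>, all signs being their own inverses.\<close>
  have key: "eps (graft v zs) * Poly_Mapping.lookup x (graft v zs) =
      ksign (X (map ty zs)) * (eps v * (prod_list (map eps zs) * Poly_Mapping.lookup (cofree_deco sM_dAs x) (v, zs)))"
    if "x \<in> C n" "dtree v" "length zs = leaves v" "\<forall>t\<in>set zs. dtree t" for v zs n x
  proof -
    have x: "x \<in> cofree sM_dAs n" using that C by (auto simp: subcooperad_def)
    have "ksign (X (map ty zs)) * (eps v * (prod_list (map eps zs) * Poly_Mapping.lookup (cofree_deco sM_dAs x) (v, zs)))
      = (ksign (X (map ty zs)) * ksign (X (map ty zs))) * (eps v * eps v)
         * (prod_list (map eps zs) * (prod_list (map eps zs) * (eps (graft v zs) * Poly_Mapping.lookup x (graft v zs))))"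
      unfolding lookup_cofree_deco[OF x] using that
      by (simp add: ac_simps del: ksign_square ksign_square_left eps_square eps_square_left)
    then show ?thesis using that by (simp add: prod_eps_square)
  qed
  have "eps (graft u ts) * Poly_Mapping.lookup x (graft u ts)
      = eps (graft u' ts') * Poly_Mapping.lookup x (graft u' ts')" if "x \<in> C n" for x n
  proof -
    have "cofree_deco sM_dAs x \<in> circ C n" using that C by (auto simp: subcooperad_def)
    from coherent_circ[OF this u ts] show ?thesis
      unfolding key[OF that d(1) len d(3)] key[OF that d(2) len' d(4)] map_ty by simp
  qed
  then show ?thesis using gd g maps ty by (simp add: coherent_def)
qed

section \<open>Reduction of trees to normal forms\<close>

primrec comb :: "nat \<Rightarrow> dAs_gen shifted tree" where
  "comb 0 = Leaf"
| "comb (Suc n) = bin Leaf (comb n)"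

text \<open>A chain of \<open>i\<close> unary vertices at the root, followed by the right comb with
  \<open>n\<close> binary vertices, hence with \<open>n + 1\<close> leaves.\<close>

primrec nform :: "nat \<Rightarrow> nat \<Rightarrow> dAs_gen shifted tree" where
  "nform 0 n = comb n"
| "nform (Suc i) n = un (nform i n)"

lemma comb_props: "dtree (comb n) \<and> nb (comb n) = 0 \<and> leaves (comb n) = Suc n"
  by (induction n) auto

lemma nform_props: "dtree (nform i n)" "nb (nform i n) = i" "leaves (nform i n) = Suc n"
  using comb_props[of n] by (induction i) auto

context
  fixes C :: "nat \<Rightarrow> (dAs_gen shifted tree \<Rightarrow>\<^sub>0 'k::comm_ring_1) set"
  assumes C: "subcooperad sM_dAs C"
    and cor: "satisfies_corelations (lin (shift2 M_dAs) ` R_dAs) C"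
begin

lemma coherent_vertices_2:
  assumes "dtree t" "dtree t'" "vertices t = 2" "vertices t' = 2" "ty t = ty t'"
  shows "coherent C t t'"
  unfolding coherent_def
proof (intro conjI allI ballI)
  fix n x assume "x \<in> C n"
  then have "restr (\<lambda>t. vertices t = 2) x \<in> lin (shift2 M_dAs) ` R_dAs"
    using cor by (auto simp: satisfies_corelations_def)
  from corelation_coherent[OF this assms]
  show "eps t * Poly_Mapping.lookup x t = eps t' * Poly_Mapping.lookup x t'"
    using assms by simp
qed (use assms in auto)

text \<open>Adding a root vertex amounts to grafting onto a corolla, which is coherent to
  itself.\<close>

lemma coherent_un: "coherent C t t' \<Longrightarrow> coherent C (un t) (un t')"
  using coherent_graft[OF C, of "un Leaf" "un Leaf" "[t]" "[t']"] by (simp add: coherent_refl)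

lemma coherent_bin: "coherent C t t' \<Longrightarrow> coherent C u u' \<Longrightarrow> coherent C (bin t u) (bin t' u')"
  using coherent_graft[OF C, of "bin Leaf Leaf" "bin Leaf Leaf" "[t, u]" "[t', u']"]
  by (simp add: coherent_refl)

text \<open>The local moves come from grafting the same trees onto two coherent trees with two
  vertices. This one reassociates to the right; the next two move a unary vertex towards the
  root.\<close>

lemma coherent_assoc:
  "dtree t \<Longrightarrow> dtree u \<Longrightarrow> dtree w \<Longrightarrow> coherent C (bin (bin t u) w) (bin t (bin u w))"
  using coherent_graft[OF C coherent_vertices_2, of "bin (bin Leaf Leaf) Leaf" "bin Leaf (bin Leaf Leaf)"
      "[t, u, w]" "[t, u, w]"]
  by (simp add: coherent_refl)

lemma coherent_un_left: "dtree t \<Longrightarrow> dtree u \<Longrightarrow> coherent C (bin (un t) u) (un (bin t u))"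
  using coherent_graft[OF C coherent_vertices_2, of "bin (un Leaf) Leaf" "un (bin Leaf Leaf)"
      "[t, u]" "[t, u]"]
  by (simp add: coherent_refl)

lemma coherent_un_right: "dtree t \<Longrightarrow> dtree u \<Longrightarrow> coherent C (bin t (un u)) (un (bin t u))"
  using coherent_graft[OF C coherent_vertices_2, of "bin Leaf (un Leaf)" "un (bin Leaf Leaf)"
      "[t, u]" "[t, u]"]
  by (simp add: coherent_refl)

lemma coherent_bin_comb: "coherent C (bin (comb m) (comb n)) (comb (Suc (m + n)))"
proof (induction m)
  case 0
  show ?case using comb_props[of n] by (simp add: coherent_refl)
next
  case (Suc m)
  have "coherent C (bin (bin Leaf (comb m)) (comb n)) (bin Leaf (bin (comb m) (comb n)))"
    using comb_props[of n] comb_props[of m] by (intro coherent_assoc) auto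
  also have "coherent C \<dots> (bin Leaf (comb (Suc (m + n))))"
    by (intro coherent_bin Suc coherent_refl) auto
  finally show ?case by simp
qed

text \<open>The unary vertices of the left factor are moved to the root first, then those of the
  right factor, until two combs remain to be merged.\<close>

lemma coherent_bin_nform: "coherent C (bin (nform i m) (nform k n)) (nform (i + k) (Suc (m + n)))"
proof (induction i)
  case 0
  show ?case
  proof (induction k)
    case 0
    then show ?case using coherent_bin_comb by simp
  next
    case (Suc k)
    have "coherent C (bin (nform 0 m) (un (nform k n))) (un (bin (nform 0 m) (nform k n)))"
      by (intro coherent_un_right nform_props)
    also have "coherent C \<dots> (un (nform (0 + k) (Suc (m + n))))"
      by (intro coherent_un Suc)
    finally show ?case by simp
  qed
next
  case (Suc i)
  have "coherent C (bin (un (nform i m)) (nform k n)) (un (bin (nform i m) (nform k n)))"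
    by (intro coherent_un_left nform_props)
  also have "coherent C \<dots> (un (nform (i + k) (Suc (m + n))))"
    by (intro coherent_un Suc)
  finally show ?case by simp
qed

lemma coherent_nform: "dtree t \<Longrightarrow> coherent C t (nform (nb t) (leaves t - 1))"
proof (induction rule: dtree.induct)
  case (un t)
  then show ?case using coherent_un by simp
next
  case (bin t u)
  have "coherent C (bin t u) (bin (nform (nb t) (leaves t - 1)) (nform (nb u) (leaves u - 1)))"
    by (intro coherent_bin bin.IH)
  also have "coherent C \<dots> (nform (nb t + nb u) (Suc (leaves t - 1 + (leaves u - 1))))"
    by (rule coherent_bin_nform)
  \<comment> \<open>The truncated subtractions are exact because every tree has a leaf.\<close>
  also have "Suc (leaves t - 1 + (leaves u - 1)) = leaves (bin t u) - 1"
    using leaves_pos[of t] leaves_pos[of u] bin.hyps by simp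
  finally show ?case by simp
qed (simp add: coherent_refl)

lemma subset_mu_span: "C n \<subseteq> mu_span n"
proof
  fix x assume xC: "x \<in> C n"
  then have x: "x \<in> cofree sM_dAs n" using C by (auto simp: subcooperad_def)
  let ?I = "nb ` Poly_Mapping.keys x"
  \<comment> \<open>The signed coefficient of \<open>x\<close> at the normal form with
    \<open>i\<close> unary vertices; coherence makes it the common value on all trees of that
    type.\<close>
  let ?c = "\<lambda>i. eps (nform i (n - 1)) * Poly_Mapping.lookup x (nform i (n - 1))"
  have "x = (\<Sum>i\<in>?I. smul (?c i) (mu i n))"
  proof (rule poly_mapping_eqI)
    fix t
    have "Poly_Mapping.lookup (\<Sum>i\<in>?I. smul (?c i) (mu i n)) t
        = (\<Sum>i\<in>?I. if i = nb t then (if dtree t \<and> leaves t = n then ?c (nb t) * eps t else 0) else 0)"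
      unfolding lookup_sum_pm by (intro sum.cong) (auto simp: lookup_mu)
    also have "\<dots> = (if nb t \<in> ?I \<and> dtree t \<and> leaves t = n then ?c (nb t) * eps t else 0)"
      by (simp add: sum.delta')
    also have "\<dots> = Poly_Mapping.lookup x t"
    proof (cases "dtree t \<and> leaves t = n")
      case True
      then have "?c (nb t) = eps t * Poly_Mapping.lookup x t"
        using coherent_nform[of t] xC by (auto simp: coherent_def)
      then have "?c (nb t) * eps t = Poly_Mapping.lookup x t"
        using True by (simp add: ac_simps)
      moreover have "Poly_Mapping.lookup x t = 0" if "nb t \<notin> ?I"
        using that by (auto simp: in_keys_iff)
      ultimately show ?thesis using True by auto
    next
      case False
      then show ?thesis using x by (auto simp: cofree_sM_iff)
    qed
    finally show "Poly_Mapping.lookup x t = Poly_Mapping.lookup (\<Sum>i\<in>?I. smul (?c i) (mu i n)) t" by simp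
  qed
  also have "\<dots> \<in> mu_span n"
    using mu_in_mu_span subspace_mu_span by (intro fm.subspace_sum fm.subspace_scale) auto
  finally show "x \<in> mu_span n" .
qed

end

section \<open>The Koszul dual cooperad and its basis\<close>

lemma is_cogenerated_mu_span: "is_cogenerated_cooperad sM_dAs (lin (shift2 M_dAs) ` R_dAs) mu_span"
  unfolding is_cogenerated_cooperad_def
  using subcooperad_mu_span corelations_mu_span subset_mu_span by blast

text \<open>Each of the two contains the other by maximality, so the definite description defining
  \<open>dAs_dual\<close> denotes \<open>mu_span\<close>.\<close>

lemma is_cogenerated_cooperad_unique:
  "is_cogenerated_cooperad V R C \<Longrightarrow> is_cogenerated_cooperad V R C' \<Longrightarrow> C = C'"
  unfolding is_cogenerated_cooperad_def by (intro ext) (meson subset_antisym)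

lemma dAs_dual_eq: "dAs_dual = mu_span"
  unfolding dAs_dual_def koszul_dual_def cogenerated_cooperad_def
  using is_cogenerated_mu_span by (blast intro: is_cogenerated_cooperad_unique)

text \<open>The coefficient at the normal form of type \<open>(i, j)\<close> is a sign in
  \<open>mu i j\<close> and 0 in every other \<open>mu i' j\<close>. Signs are invertible, so this
  yields independence over any commutative ring.\<close>

lemma is_basis_mu:
  assumes "1 \<le> j"
  shows "is_basis (\<lambda>i. mu i j :: _ \<Rightarrow>\<^sub>0 'k::comm_ring_1) UNIV (mu_span j)"
proof -
  let ?t = "\<lambda>i. nform i (j - 1)"
  have l: "Poly_Mapping.lookup (mu i' j) (?t i) = (if i' = i then eps (?t i) else 0 :: 'k)" for i i'
    using assms by (auto simp: lookup_mu nform_props)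
  have nz: "eps (?t i) \<noteq> (0::'k)" for i
    by (intro eps_nonzero nform_props)
  have inj: "inj (\<lambda>i. mu i j :: _ \<Rightarrow>\<^sub>0 'k)"
  proof (rule injI, rule ccontr)
    fix i i' assume "mu i j = (mu i' j :: _ \<Rightarrow>\<^sub>0 'k)" "i \<noteq> i'"
    then show False using l[of i i] l[of i' i] nz[of i] by simp
  qed
  have "\<not> fm_dependent (range (\<lambda>i. mu i j :: _ \<Rightarrow>\<^sub>0 'k))"
    unfolding fm.independent_explicit_module
  proof (intro allI impI)
    fix T and a :: "(_ \<Rightarrow>\<^sub>0 'k) \<Rightarrow> 'k" and v
    assume T: "finite T" "T \<subseteq> range (\<lambda>i. mu i j)" "(\<Sum>v\<in>T. smul (a v) v) = 0" "v \<in> T"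
    then obtain i where v: "v = mu i j" by auto
    \<comment> \<open>Evaluating the relation at the normal form belonging to \<open>v\<close>
      isolates its coefficient up to a sign.\<close>
    have "(\<Sum>w\<in>T. a w * Poly_Mapping.lookup w (?t i)) = (\<Sum>w\<in>T. if w = v then a v * eps (?t i) else 0)"
    proof (rule sum.cong)
      fix w assume "w \<in> T"
      then obtain i' where w: "w = mu i' j" using T by auto
      have "w = v \<longleftrightarrow> i' = i" using inj by (auto simp: w v inj_def)
      then show "a w * Poly_Mapping.lookup w (?t i) = (if w = v then a v * eps (?t i) else 0)"
        using l[of i' i] by (simp add: w v)
    qed simp
    also have "\<dots> = a v * eps (?t i)" using T by simp
    finally have "a v * eps (?t i) = 0"
      using arg_cong[OF T(3), of "\<lambda>x. Poly_Mapping.lookup x (?t i)"] by (simp add: lookup_sum_pm)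
    then have "eps (?t i) * (eps (?t i) * a v) = 0" by (simp add: ac_simps)
    then show "a v = 0" by (simp add: nform_props)
  qed
  then show ?thesis using inj by (simp add: is_basis_def mu_span_def)
qed

theorem theorem2p8:
  shows
    "is_cogenerated_cooperad sM_dAs (lin (shift2 M_dAs) ` R_dAs)
        (dAs_dual :: nat \<Rightarrow> (dAs_gen shifted tree \<Rightarrow>\<^sub>0 'k::comm_ring_1) set)
     \<and> (\<forall>n. \<forall>x \<in> cofree sM_dAs n. cofree_diff sM_dAs (x :: dAs_gen shifted tree \<Rightarrow>\<^sub>0 'k) = 0)
     \<and> (\<forall>n. \<forall>x \<in> dAs_dual n. cofree_diff sM_dAs (x :: dAs_gen shifted tree \<Rightarrow>\<^sub>0 'k) = 0)
     \<and> dAs_dual 0 = {0 :: dAs_gen shifted tree \<Rightarrow>\<^sub>0 'k}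
     \<and> (\<forall>j\<ge>1. is_basis (\<lambda>i. mu i j :: dAs_gen shifted tree \<Rightarrow>\<^sub>0 'k) UNIV (dAs_dual j))
     \<and> (mu 0 1 :: dAs_gen shifted tree \<Rightarrow>\<^sub>0 'k) = bas Leaf
     \<and> (mu 0 2 :: dAs_gen shifted tree \<Rightarrow>\<^sub>0 'k)
          = bas (corolla (sM_dAs :: (dAs_gen shifted, 'k) coll) (S m02))
     \<and> (mu 1 1 :: dAs_gen shifted tree \<Rightarrow>\<^sub>0 'k)
          = bas (corolla (sM_dAs :: (dAs_gen shifted, 'k) coll) (S m11))
     \<and> (\<forall>i j. 1 \<le> j \<longrightarrow> (\<forall>t \<in> Poly_Mapping.keys (mu i j :: dAs_gen shifted tree \<Rightarrow>\<^sub>0 'k).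
          tdeg (sM_dAs :: (dAs_gen shifted, 'k) coll) t = (i, 1 - int i - int j)))
     \<and> (\<forall>u v. 1 \<le> v \<longrightarrow>
          cofree_deco sM_dAs (mu u v :: dAs_gen shifted tree \<Rightarrow>\<^sub>0 'k)
          = (\<Sum>(i, ps) \<in> deco_index u v.
               smul (ksign (X ps)) (tens2 (mu i (length ps)) (tens (map (\<lambda>(p, q). mu p q) ps)))))
     \<and> (\<forall>ps. (\<forall>(p, q)\<in>set ps. 1 \<le> q) \<longrightarrow> X ps mod 2 = X' ps mod 2)"
proof -
  have node_bas: "node (S m11) [bas t] = (bas (un t) :: _ \<Rightarrow>\<^sub>0 'k)"
    "node (S m02) [bas t, bas u] = (bas (bin t u) :: _ \<Rightarrow>\<^sub>0 'k)" for t u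
    by (simp_all add: node_def)
  have mu01: "mu 0 1 = (bas Leaf :: _ \<Rightarrow>\<^sub>0 'k)"
    by (subst mu.simps) simp
  moreover have "mu 1 1 = (bas (un Leaf) :: _ \<Rightarrow>\<^sub>0 'k)"
    using mu01 node_bas by (subst mu.simps) simp
  moreover have "splits 0 2 = {(0, 0, 1, 1)}" by (auto simp: splits_def)
  then have "mu 0 2 = (bas (bin Leaf Leaf) :: _ \<Rightarrow>\<^sub>0 'k)"
    using mu01 node_bas
    by (subst mu_rec) (simp_all add: bin_sign_def mu_deg_def shift_bideg_def)
  moreover have "X ps mod 2 = X' ps mod 2" for ps
    using X_X'[of ps] by (simp add: mod_eq_dvd_iff)
  moreover have "tdeg (sM_dAs :: (_, 'k) coll) t = (i, 1 - int i - int j)"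
    if "t \<in> Poly_Mapping.keys (mu i j :: _ \<Rightarrow>\<^sub>0 'k)" for t i j
    using that by (auto simp: in_keys_iff lookup_mu tdeg_dtree mu_deg_def split: if_splits)
  ultimately show ?thesis
    unfolding dAs_dual_eq
    by (intro conjI allI ballI impI is_cogenerated_mu_span cofree_diff_sM_dAs cofree_deco_mu
        is_basis_mu mu_span_0) (simp_all add: corolla_def numeral_2_eq_2)
qed

end
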